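(* Let $T>0$. Let $f\in C([0,T];L^1(\mathbb{T}^d\times\mathbb{R}^d))$ be a dissipative solution of the Boltzmann equation $(\partial_t+v\cdot\nabla_x)f=Q(f)$ and let $g:\mathbb{T}^d\times\mathbb{R}^d\times[0,T]\to\mathbb{R}$ be a sufficiently regular function (both notions as defined in the context) such that $f|_{t=0}\le g|_{t=0}$, $$\partial_t g+v\cdot\nabla_x g-Q(f,g)\ge 0\quad\text{on }U,$$ and $$f\le g\quad\text{on }U^c,$$ where $U$ is a measurable subset of $\mathbb{T}^d\times\mathbb{R}^d\times[0,T]$ and $U^c$ is its complement in that set. Then $f\le g$ almost everywhere on $\mathbb{T}^d\times\mathbb{R}^d$, for every $t\in[0,T]$.
   Context: Here $d\ge 2$ and $\mathbb{T}^d$ is the $d$-dimensional torus. The kernel $B(v-v_*,\sigma)\ge 0$ is a measurable function with the usual symmetries, i.e. depending only on $|v-v_*|$ and on $\cos\vartheta=\frac{(v-v_* )\cdot\sigma}{|v-v_*|}$. The bilinear collision forms are $$Q^+(f,u)=\int_{\mathbb{R}^d}\int_{S^{d-1}}f'_*\,u'\,B(v-v_*,\sigma)\,d\sigma\,dv_*,\quad Q^-(f,u)=\int_{\mathbb{R}^d}\int_{S^{d-1}}f_*\,u\,B(v-v_*,\sigma)\,d\sigma\,dv_*,\quad Q(f,u)=Q^+(f,u)-Q^-(f,u),$$ where $f_*=f(x,v_*,t)$, $u=u(x,v,t)$, $f'_*=f(x,v'_*,t)$, $u'=u(x,v',t)$, $v'=\frac{v+v_*}{2}+\frac{|v-v_*|}{2}\sigma$,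 $v'_*=\frac{v+v_*}{2}-\frac{|v-v_*|}{2}\sigma$; and $Q^\pm(f)=Q^\pm(f,f)$, $Q(f)=Q(f,f)$. Renormalized solution of $(\partial_t+v\cdot\nabla_x)f=Q(f)$: $f\ge 0$, $f\in C([0,T];L^1(\mathbb{T}^d\times\mathbb{R}^d))$, $Q^\pm(f)/(1+f)\in L^1_{\rm loc}$, and $(\partial_t+v\cdot\nabla_x)\log(1+f)=Q(f)/(1+f)$ in the sense of distributions. Dissipative solution: a renormalized solution $f$ such that $f|v|^2\in L^\infty([0,T];L^1(\mathbb{T}^d\times\mathbb{R}^d))$ and for every sufficiently regular $g:\mathbb{T}^d\times\mathbb{R}^d\times[0,T]\to\mathbb{R}$, $$\partial_t\int_{\mathbb{R}^d}|f-g|\,dv+\mathrm{div}_x\int_{\mathbb{R}^d}|f-g|\,v\,dv\le\int_{\mathbb{R}^d}\big(Q(f,g)-D(g)\big)\,\mathrm{sign}(f-g)\,dv$$ in the sense of distributions, where $D(g)=(\partial_t+v\cdot\nabla_x)g$, $\mathrm{sign}(z)=1$ for $z>0$, $-1$ for $z<0$, and $\mathrm{sign}(0)$ may be assigned an arbitrary value in $[-1,1]$. Sufficiently regular: $g\in C([0,T];L^1_{xv})$, $g|v|^2\in L^\infty_t(L^1_{xv})$, $D(g)\in L^1_{xvt}$, and for every $\tilde f\in C([0,T];L^1_{xv})$ with $\tilde f|v|^2\in L^\infty_t(L^1_{xv})$ one has $Q^+(\tilde f,|g|),\,Q^-(\tilde f,|g|)\in L^1_{xvt}$. *)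

theory Defs
  imports "HOL-Analysis.Analysis"
begin

section \<open>Phase space\<close>

text \<open>
  Points of phase space are triples (x, v, t). A function on the torus is a function on R^d
  that is Z^d-periodic in x; integrals over the torus and subsets of the torus live on the
  fundamental cell [0,1)^d. Elements of L^1 are represented by Borel functions.
\<close>

type_synonym 'd point = "(real ^ 'd) \<times> (real ^ 'd) \<times> real"

definition torus_cell :: "(real ^ 'd) set" where
  "torus_cell = {x. \<forall>i. 0 \<le> x $ i \<and> x $ i < 1}"

definition integer_vectors :: "(real ^ 'd) set" where
  "integer_vectors = {k. \<forall>i. k $ i \<in> \<int>}"

definition torus_measure :: "(real ^ 'd) measure" where
  "torus_measure = restrict_space lborel torus_cell"

definition time_measure :: "real \<Rightarrow> real measure" where
  "time_measure T = restrict_space lborel {0..T}"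

definition xv_measure :: "((real ^ 'd) \<times> (real ^ 'd)) measure" where
  "xv_measure = torus_measure \<Otimes>\<^sub>M lborel"

definition xt_measure :: "real \<Rightarrow> ((real ^ 'd) \<times> real) measure" where
  "xt_measure T = torus_measure \<Otimes>\<^sub>M time_measure T"

definition xvt_measure :: "real \<Rightarrow> 'd::finite point measure" where
  "xvt_measure T = torus_measure \<Otimes>\<^sub>M (lborel \<Otimes>\<^sub>M time_measure T)"

section \<open>Function spaces\<close>

text \<open>
  Membership in C([0,T]; L^1): joint measurability is part of the definition, since every
  continuous curve in L^1 has a jointly measurable representative.
\<close>

definition continuous_L1 :: "real \<Rightarrow> ('d::finite point \<Rightarrow> real) \<Rightarrow> bool" where
  "continuous_L1 T f \<longleftrightarrow>
     (\<forall>x v. \<forall>t\<in>{0..T}. \<forall>k\<in>integer_vectors. f (x + k, v, t) = f (x, v, t)) \<and>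
     f \<in> borel_measurable (xvt_measure T) \<and>
     (\<forall>t\<in>{0..T}. integrable xv_measure (\<lambda>(x, v). f (x, v, t))) \<and>
     (\<forall>t\<in>{0..T}.
        ((\<lambda>s. LINT (x, v)|xv_measure. \<bar>f (x, v, s) - f (x, v, t)\<bar>) \<longlongrightarrow> 0)
          (at t within {0..T}))"

definition bounded_energy :: "real \<Rightarrow> ('d::finite point \<Rightarrow> real) \<Rightarrow> bool" where
  "bounded_energy T f \<longleftrightarrow>
     (\<exists>C. AE t in time_measure T.
        integrable xv_measure (\<lambda>(x, v). f (x, v, t) * (norm v)\<^sup>2) \<and>
        (LINT (x, v)|xv_measure. \<bar>f (x, v, t) * (norm v)\<^sup>2\<bar>) \<le> C)"

text \<open>
  Local integrability on the torus times R^d times the open interval (0,T). The torus is compact,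
  so only (v, t) has to be confined to a compact set.
\<close>

definition locally_L1 :: "real \<Rightarrow> ('d::finite point \<Rightarrow> real) \<Rightarrow> bool" where
  "locally_L1 T h \<longleftrightarrow>
     (\<forall>K. compact K \<and> K \<subseteq> UNIV \<times> {0<..<T} \<longrightarrow>
        set_integrable (xvt_measure T) {(x, v, t). (v, t) \<in> K} h)"

section \<open>Test functions\<close>

primrec C_k :: "nat \<Rightarrow> ('a::euclidean_space \<Rightarrow> real) \<Rightarrow> bool" where
  "C_k 0 h \<longleftrightarrow> continuous_on UNIV h"
| "C_k (Suc k) h \<longleftrightarrow>
     (\<forall>x. h differentiable (at x)) \<and>
     (\<forall>b\<in>Basis. C_k k (\<lambda>x. frechet_derivative h (at x) b))"

definition smooth :: "('a::euclidean_space \<Rightarrow> real) \<Rightarrow> bool" where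
  "smooth h \<longleftrightarrow> (\<forall>k. C_k k h)"

definition test_xvt :: "real \<Rightarrow> ('d::finite point \<Rightarrow> real) \<Rightarrow> bool" where
  "test_xvt T \<phi> \<longleftrightarrow>
     smooth \<phi> \<and>
     (\<forall>x v t. \<forall>k\<in>integer_vectors. \<phi> (x + k, v, t) = \<phi> (x, v, t)) \<and>
     (\<exists>K. compact K \<and> K \<subseteq> UNIV \<times> {0<..<T} \<and>
        (\<forall>x v t. (v, t) \<notin> K \<longrightarrow> \<phi> (x, v, t) = 0))"

definition test_xt :: "real \<Rightarrow> ((real ^ 'd::finite) \<times> real \<Rightarrow> real) \<Rightarrow> bool" where
  "test_xt T \<psi> \<longleftrightarrow>
     smooth \<psi> \<and>
     (\<forall>x t. \<forall>k\<in>integer_vectors. \<psi> (x + k, t) = \<psi> (x, t)) \<and>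
     (\<exists>K. compact K \<and> K \<subseteq> {0<..<T} \<and> (\<forall>x t. t \<notin> K \<longrightarrow> \<psi> (x, t) = 0))"

section \<open>Transport operator\<close>

text \<open>
  The equation \<open>(\<partial>\<^sub>t + v \<cdot> \<nabla>\<^sub>x) u = h\<close> in the sense of distributions on the torus
  times R^d times (0,T). The derivative of a test function in direction (v, 0, 1) is
  \<open>(\<partial>\<^sub>t + v \<cdot> \<nabla>\<^sub>x) \<phi>\<close>.
\<close>

definition transport_eq ::
  "real \<Rightarrow> ('d::finite point \<Rightarrow> real) \<Rightarrow> ('d point \<Rightarrow> real) \<Rightarrow> bool" where
  "transport_eq T u h \<longleftrightarrow>
     (\<forall>\<phi>. test_xvt T \<phi> \<longrightarrow>
        - (LINT (x, v, t)|xvt_measure T.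
             u (x, v, t) * frechet_derivative \<phi> (at (x, v, t)) (v, 0, 1)) =
        (LINT p|xvt_measure T. h p * \<phi> p))"

text \<open>The distribution D(g) is the integrable function h; it determines h almost everywhere.\<close>

definition has_transport_derivative ::
  "real \<Rightarrow> ('d::finite point \<Rightarrow> real) \<Rightarrow> ('d point \<Rightarrow> real) \<Rightarrow> bool" where
  "has_transport_derivative T g h \<longleftrightarrow>
     (\<forall>x v. \<forall>t\<in>{0..T}. \<forall>k\<in>integer_vectors. h (x + k, v, t) = h (x, v, t)) \<and>
     integrable (xvt_measure T) h \<and> transport_eq T g h"

section \<open>Collision operator\<close>

text \<open>
  Surface measure of the unit sphere: the measure of a set A is d times the Lebesgue measure of the
  cone {r a | a in A, 0 < r < 1}. On vectors, \<^term>\<open>sgn x\<close> is x / |x|.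
\<close>

definition sphere_measure :: "(real ^ 'd) measure" where
  "sphere_measure =
     scale_measure (of_nat CARD('d))
       (distr (restrict_space lborel (ball 0 1 - {0})) (restrict_space borel (sphere 0 1)) sgn)"

definition collision_kernel :: "((real ^ 'd) \<Rightarrow> (real ^ 'd) \<Rightarrow> real) \<Rightarrow> bool" where
  "collision_kernel B \<longleftrightarrow>
     (\<lambda>(z, \<sigma>). B z \<sigma>) \<in> borel_measurable (lborel \<Otimes>\<^sub>M sphere_measure) \<and>
     (\<forall>z. \<forall>\<sigma>\<in>sphere 0 1. 0 \<le> B z \<sigma>) \<and>
     (\<exists>b. \<forall>z. \<forall>\<sigma>\<in>sphere 0 1. z \<noteq> 0 \<longrightarrow> B z \<sigma> = b (norm z) (z \<bullet> \<sigma> / norm z))"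

definition post_v :: "real ^ 'd \<Rightarrow> real ^ 'd \<Rightarrow> real ^ 'd \<Rightarrow> real ^ 'd" where
  "post_v v w \<sigma> = (1 / 2) *\<^sub>R (v + w) + (norm (v - w) / 2) *\<^sub>R \<sigma>"

definition post_w :: "real ^ 'd \<Rightarrow> real ^ 'd \<Rightarrow> real ^ 'd \<Rightarrow> real ^ 'd" where
  "post_w v w \<sigma> = (1 / 2) *\<^sub>R (v + w) - (norm (v - w) / 2) *\<^sub>R \<sigma>"

definition gain_integrand ::
  "((real ^ 'd) \<Rightarrow> (real ^ 'd) \<Rightarrow> real) \<Rightarrow> ('d::finite point \<Rightarrow> real) \<Rightarrow> ('d point \<Rightarrow> real) \<Rightarrow>
   'd point \<Rightarrow> (real ^ 'd) \<times> (real ^ 'd) \<Rightarrow> real" where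
  "gain_integrand B f u = (\<lambda>(x, v, t) (w, \<sigma>).
     f (x, post_w v w \<sigma>, t) * u (x, post_v v w \<sigma>, t) * B (v - w) \<sigma>)"

definition loss_integrand ::
  "((real ^ 'd) \<Rightarrow> (real ^ 'd) \<Rightarrow> real) \<Rightarrow> ('d::finite point \<Rightarrow> real) \<Rightarrow> ('d point \<Rightarrow> real) \<Rightarrow>
   'd point \<Rightarrow> (real ^ 'd) \<times> (real ^ 'd) \<Rightarrow> real" where
  "loss_integrand B f u = (\<lambda>(x, v, t) (w, \<sigma>).
     f (x, w, t) * u (x, v, t) * B (v - w) \<sigma>)"

definition Q_plus ::
  "((real ^ 'd) \<Rightarrow> (real ^ 'd) \<Rightarrow> real) \<Rightarrow> ('d::finite point \<Rightarrow> real) \<Rightarrow> ('d point \<Rightarrow> real) \<Rightarrow>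
   'd point \<Rightarrow> real" where
  "Q_plus B f u p = (LINT q|(lborel \<Otimes>\<^sub>M sphere_measure). gain_integrand B f u p q)"

definition Q_minus ::
  "((real ^ 'd) \<Rightarrow> (real ^ 'd) \<Rightarrow> real) \<Rightarrow> ('d::finite point \<Rightarrow> real) \<Rightarrow> ('d point \<Rightarrow> real) \<Rightarrow>
   'd point \<Rightarrow> real" where
  "Q_minus B f u p = (LINT q|(lborel \<Otimes>\<^sub>M sphere_measure). loss_integrand B f u p q)"

definition Q ::
  "((real ^ 'd) \<Rightarrow> (real ^ 'd) \<Rightarrow> real) \<Rightarrow> ('d::finite point \<Rightarrow> real) \<Rightarrow> ('d point \<Rightarrow> real) \<Rightarrow>
   'd point \<Rightarrow> real" where
  "Q B f u p = Q_plus B f u p - Q_minus B f u p"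

text \<open>
  The Bochner integral of a non-integrable function is 0, so that membership of a collision term
  in L^1 or in local L^1 must always be accompanied by almost everywhere convergence of the
  integrals defining it.
\<close>

definition collision_converges ::
  "((real ^ 'd) \<Rightarrow> (real ^ 'd) \<Rightarrow> real) \<Rightarrow> real \<Rightarrow>
   ('d::finite point \<Rightarrow> real) \<Rightarrow> ('d point \<Rightarrow> real) \<Rightarrow> bool" where
  "collision_converges B T f u \<longleftrightarrow>
     (AE p in xvt_measure T.
        integrable (lborel \<Otimes>\<^sub>M sphere_measure) (gain_integrand B f u p) \<and>
        integrable (lborel \<Otimes>\<^sub>M sphere_measure) (loss_integrand B f u p))"

section \<open>Notions of solution\<close>

definition renormalized_solution ::
  "((real ^ 'd) \<Rightarrow> (real ^ 'd) \<Rightarrow> real) \<Rightarrow> real \<Rightarrow> ('d::finite point \<Rightarrow> real) \<Rightarrow> bool" where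
  "renormalized_solution B T f \<longleftrightarrow>
     (AE p in xvt_measure T. 0 \<le> f p) \<and>
     continuous_L1 T f \<and>
     collision_converges B T f f \<and>
     locally_L1 T (\<lambda>p. Q_plus B f f p / (1 + f p)) \<and>
     locally_L1 T (\<lambda>p. Q_minus B f f p / (1 + f p)) \<and>
     transport_eq T (\<lambda>p. ln (1 + f p)) (\<lambda>p. Q B f f p / (1 + f p))"

definition sufficiently_regular ::
  "((real ^ 'd) \<Rightarrow> (real ^ 'd) \<Rightarrow> real) \<Rightarrow> real \<Rightarrow> ('d::finite point \<Rightarrow> real) \<Rightarrow> bool" where
  "sufficiently_regular B T g \<longleftrightarrow>
     continuous_L1 T g \<and>
     bounded_energy T g \<and>
     (\<exists>h. has_transport_derivative T g h) \<and>
     (\<forall>f. continuous_L1 T f \<and> bounded_energy T f \<longrightarrow>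
        collision_converges B T f (\<lambda>p. \<bar>g p\<bar>) \<and>
        integrable (xvt_measure T) (Q_plus B f (\<lambda>p. \<bar>g p\<bar>)) \<and>
        integrable (xvt_measure T) (Q_minus B f (\<lambda>p. \<bar>g p\<bar>)))"

definition sign_with :: "real \<Rightarrow> real \<Rightarrow> real" where
  "sign_with \<theta> z = (if z = 0 then \<theta> else sgn z)"

text \<open>
  The inequality \<open>\<partial>\<^sub>t \<rho> + div\<^sub>x j \<le> r\<close> in the sense of distributions on the torus times (0,T).
  The derivative of a test function in direction \<open>(j, \<rho>)\<close> is
  \<open>\<rho> \<partial>\<^sub>t \<psi> + j \<cdot> \<nabla>\<^sub>x \<psi>\<close>.
\<close>

definition balance_le ::
  "real \<Rightarrow> ((real ^ 'd::finite) \<times> real \<Rightarrow> real) \<Rightarrow> ((real ^ 'd) \<times> real \<Rightarrow> real ^ 'd) \<Rightarrow>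
   ((real ^ 'd) \<times> real \<Rightarrow> real) \<Rightarrow> bool" where
  "balance_le T \<rho> j r \<longleftrightarrow>
     (\<forall>\<psi>. test_xt T \<psi> \<and> (\<forall>y. 0 \<le> \<psi> y) \<longrightarrow>
        - (LINT y|xt_measure T. frechet_derivative \<psi> (at y) (j y, \<rho> y)) \<le>
        (LINT y|xt_measure T. r y * \<psi> y))"

definition dissipative_solution ::
  "((real ^ 'd) \<Rightarrow> (real ^ 'd) \<Rightarrow> real) \<Rightarrow> real \<Rightarrow> ('d::finite point \<Rightarrow> real) \<Rightarrow> bool" where
  "dissipative_solution B T f \<longleftrightarrow>
     renormalized_solution B T f \<and>
     bounded_energy T f \<and>
     (\<forall>g Dg. sufficiently_regular B T g \<and> has_transport_derivative T g Dg \<longrightarrow>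
        (\<forall>\<theta>\<in>{-1..1}.
           balance_le T
             (\<lambda>(x, t). LINT v|lborel. \<bar>f (x, v, t) - g (x, v, t)\<bar>)
             (\<lambda>(x, t). LINT v|lborel. \<bar>f (x, v, t) - g (x, v, t)\<bar> *\<^sub>R v)
             (\<lambda>(x, t). LINT v|lborel.
                (Q B f g (x, v, t) - Dg (x, v, t)) *
                sign_with \<theta> (f (x, v, t) - g (x, v, t)))))"

end

theory Submission
  imports Defs
begin

text \<open>
  Put $W = |f - g| + f - g = 2 (f - g)_+$ and let $M(t)$ be the integral of $W$ over phase space at
  time $t$. Add up three facts, integrated against a test function of time: the dissipative
  inequality for $g$ with sign$(0) = -1$; the dissipative inequality for the function 0, which says that
  the mass of $f$ does not increase; and the transport equation of $g$. The integral of $Q(f,g)$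
  vanishes, because the change of variables between velocities before and after a collision
  preserves the measure $dv\, dv_*\, d\sigma$. The result is that $M'$ is at most the integral of
  $(Q(f,g) - D(g)) (\mathrm{sign}(f - g) + 1)$. The second factor vanishes where $f \le g$, and where
  $f > g$ the point lies in $U$, so that the first factor is nonpositive. Hence the continuous
  function $M \ge 0$ is nonincreasing, and it vanishes at time 0.
\<close>

section \<open>Smooth functions\<close>

text \<open>The value -1 for sign(0) matters: where f = g the point may lie outside U, and nothing
  is known there about Q(f,g) - D(g); this choice removes that set from the estimate. The
  cancellation of gain against loss requires absolute integrability over all of (x, v, t, w,
  \<sigma>), while the regularity of g controls only iterated integrals with |g|. Applying it to |f|
  and |g|, with B nonnegative, bridges the gap by Fubini. That collisions preserve measure becomes
  visible in the centre of mass and the relative velocity: the centre stays fixed, and the direction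
  of the relative velocity changes places with \<sigma>. Polar coordinates show these two directions
  to be interchangeable. Admissible test functions have compact support in the open interval (0,T),
  so monotonicity of M is first obtained there and reaches both endpoints by continuity.\<close>

lemma C_k_SucI:
  assumes "\<And>x. (h has_derivative h' x) (at x)"
    and "\<And>b. b \<in> Basis \<Longrightarrow> C_k k (\<lambda>x. h' x b)"
  shows "C_k (Suc k) h"
proof -
  have "frechet_derivative h (at x) = h' x" for x
    using frechet_derivative_at[OF assms(1)] by simp
  moreover have "h differentiable at x" for x
    using assms(1) differentiable_def by blast
  ultimately show ?thesis using assms(2) by simp
qed

lemma C_k_SucD:
  assumes "C_k (Suc k) h"
  shows "(h has_derivative frechet_derivative h (at x)) (at x)"
    and "b \<in> Basis \<Longrightarrow> C_k k (\<lambda>x. frechet_derivative h (at x) b)"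
  using assms frechet_derivative_works by auto

text \<open>The product and chain rules leave undifferentiated factors behind; inductions on the
  order need these factors at one order less.\<close>

lemma C_k_lower: "C_k (Suc k) h \<Longrightarrow> C_k k h"
proof (induction k arbitrary: h)
  case 0
  then show ?case
    by (auto simp: continuous_on_eq_continuous_at intro: differentiable_imp_continuous_within)
next
  case (Suc k)
  then show ?case by (metis C_k.simps(2))
qed

lemma C_k_const: "C_k k (\<lambda>_. c)"
proof (induction k arbitrary: c)
  case (Suc k)
  show ?case by (rule C_k_SucI[where h' = "\<lambda>_ _. 0"]) (use Suc in auto)
qed simp

lemma C_k_linear:
  assumes "bounded_linear h"
  shows "C_k k h"
proof (cases k)
  case 0
  with assms show ?thesis
    by (simp add: linear_continuous_on)
next
  case (Suc m)
  show ?thesis unfolding Suc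
    by (rule C_k_SucI[where h' = "\<lambda>_. h"])
       (use assms in \<open>auto simp: C_k_const bounded_linear_imp_has_derivative\<close>)
qed

lemma C_k_add: "C_k k u \<Longrightarrow> C_k k w \<Longrightarrow> C_k k (\<lambda>x. u x + w x)"
proof (induction k arbitrary: u w)
  case 0
  then show ?case by (simp add: continuous_on_add)
next
  case (Suc k)
  note D = C_k_SucD[OF Suc.prems(1)] C_k_SucD[OF Suc.prems(2)]
  show ?case
    by (rule C_k_SucI[OF has_derivative_add[OF D(1) D(3)]]) (rule Suc.IH[OF D(2) D(4)])
qed

lemma C_k_mult: "C_k k u \<Longrightarrow> C_k k w \<Longrightarrow> C_k k (\<lambda>x. u x * w x)"
proof (induction k arbitrary: u w)
  case 0
  then show ?case by (simp add: continuous_on_mult)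
next
  case (Suc k)
  note D = C_k_SucD[OF Suc.prems(1)] C_k_SucD[OF Suc.prems(2)]
  note L = Suc.prems[THEN C_k_lower]
  show ?case
    by (rule C_k_SucI[OF has_derivative_mult[OF D(1) D(3)]])
       (rule C_k_add[OF Suc.IH[OF L(1) D(4)] Suc.IH[OF D(2) L(2)]])
qed

text \<open>With a real argument, the derivative of G is multiplication by its value at 1. The chain
  rule thus produces a product, whose outer factor is again a composition with \<open>u\<close>, now
  of order \<open>k\<close>; hence the induction over arbitrary G.\<close>

lemma C_k_compose:
  fixes G :: "real \<Rightarrow> real"
  shows "C_k k G \<Longrightarrow> C_k k u \<Longrightarrow> C_k k (\<lambda>x. G (u x))"
proof (induction k arbitrary: G u)
  case 0
  then show ?case
    by (auto intro: continuous_on_compose2)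
next
  case (Suc k)
  note D = C_k_SucD[OF Suc.prems(1)] C_k_SucD[OF Suc.prems(2)]
  have lin: "frechet_derivative G (at y) s = s * frechet_derivative G (at y) 1" for y s
    using linear_scale[OF has_derivative_linear[OF D(1)[of y]], of s 1] by simp
  let ?G' = "\<lambda>x b. frechet_derivative u (at x) b * frechet_derivative G (at (u x)) 1"
  have deriv: "((\<lambda>x. G (u x)) has_derivative ?G' x) (at x)" for x
    by (rule has_derivative_eq_rhs[OF has_derivative_compose[OF D(3)[of x] D(1)[of "u x"]]])
       (rule ext, rule lin)
  have outer: "C_k k (\<lambda>x. frechet_derivative G (at (u x)) 1)"
    using Suc.IH[OF D(2) C_k_lower[OF Suc.prems(2)], of 1] by simp
  show ?case
    by (rule C_k_SucI[of _ ?G', OF deriv C_k_mult[OF D(4) outer]])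
qed

lemma smooth_const: "smooth (\<lambda>_. c)"
  and smooth_linear: "bounded_linear h \<Longrightarrow> smooth h"
  and smooth_add: "smooth u \<Longrightarrow> smooth w \<Longrightarrow> smooth (\<lambda>x. u x + w x)"
  and smooth_mult: "smooth u \<Longrightarrow> smooth w \<Longrightarrow> smooth (\<lambda>x. u x * w x)"
  and smooth_compose: "smooth G \<Longrightarrow> smooth u \<Longrightarrow> smooth (\<lambda>x. G (u x))"
  by (simp_all add: smooth_def C_k_const C_k_linear C_k_add C_k_mult C_k_compose)

lemma smooth_diff: "smooth u \<Longrightarrow> smooth w \<Longrightarrow> smooth (\<lambda>x. u x - w x)"
  using smooth_add[OF _ smooth_mult[OF smooth_const[of "-1"]], of u w] by simp

lemma smooth_continuous: "smooth u \<Longrightarrow> continuous_on UNIV u"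
  unfolding smooth_def by (metis C_k.simps(1))

text \<open>This serves the test function built below as an integral of a bump: its derivative is
  known to be smooth, and the next order follows from that alone.\<close>

lemma smooth_antiderivative:
  fixes G :: "real \<Rightarrow> real"
  assumes "\<And>x. (G has_real_derivative G' x) (at x)" and "smooth G'"
  shows "smooth G"
  unfolding smooth_def
proof
  fix k
  show "C_k k G"
  proof (cases k)
    case 0
    then show ?thesis
      using assms(1) by (auto simp: continuous_on_eq_continuous_at intro: DERIV_isCont)
  next
    case (Suc m)
    show ?thesis unfolding Suc
      by (rule C_k_SucI[where h' = "\<lambda>x b. G' x * b"])
         (use assms in \<open>auto simp: smooth_def has_field_derivative_def\<close>)
  qed
qed

text \<open>The classical flat function exp(-1/s). The extra powers of 1/s make the family closed
  under differentiation up to linear combinations, so that smoothness is a single induction over all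
  \<open>n\<close>.\<close>

definition flat_exp :: "nat \<Rightarrow> real \<Rightarrow> real" where
  "flat_exp n s = (if s > 0 then exp (- (1 / s)) / s ^ n else 0)"

text \<open>From the right, r = 1/s turns the expression into r^n / exp r with r tending to
  infinity; from the left the function is 0.\<close>

lemma flat_exp_tendsto_0: "(flat_exp n \<longlongrightarrow> 0) (at 0)"
proof (rule filterlim_split_at)
  show "(flat_exp n \<longlongrightarrow> 0) (at_left 0)"
    by (rule tendsto_eventually) (auto simp: flat_exp_def eventually_at_left_field intro: exI[of _ "-1"])
  have "((\<lambda>s. (inverse s) ^ n / exp (inverse s)) \<longlongrightarrow> 0) (at_right (0::real))"
    by (rule filterlim_compose[OF tendsto_power_div_exp_0 filterlim_inverse_at_top_right])
  then show "(flat_exp n \<longlongrightarrow> 0) (at_right 0)"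
    by (rule Lim_transform_eventually)
       (auto simp: flat_exp_def eventually_at_right_field exp_minus field_simps power_inverse intro: exI[of _ 1])
qed

lemma flat_exp_deriv:
  "(flat_exp n has_real_derivative flat_exp (n + 2) s - n * flat_exp (n + 1) s) (at s)"
proof -
  consider "s > 0" | "s < 0" | "s = 0" by linarith
  then show ?thesis
  proof cases
    case 1
    have pow: "((\<lambda>s. (1 / s) ^ n) has_real_derivative - n * (1 / s) ^ (n + 1)) (at s)"
    proof -
      have "((\<lambda>s. 1 / s) has_real_derivative - (1 / s)\<^sup>2) (at s)"
        using 1 by (auto intro!: derivative_eq_intros simp: power2_eq_square)
      from DERIV_power[OF this, of n] show ?thesis
        by (rule DERIV_cong) (use 1 in \<open>cases n; simp add: power2_eq_square field_simps\<close>)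
    qed
    have "((\<lambda>s. exp (- (1 / s))) has_real_derivative exp (- (1 / s)) * (1 / s)\<^sup>2) (at s)"
      using 1 by (auto intro!: derivative_eq_intros simp: power2_eq_square)
    from DERIV_mult[OF this pow] have "((\<lambda>s. exp (- (1 / s)) / s ^ n) has_real_derivative
        flat_exp (n + 2) s - n * flat_exp (n + 1) s) (at s)"
      using 1 by (simp add: flat_exp_def power_one_over field_simps power2_eq_square)
    moreover have "open {0::real<..}" by simp
    ultimately show ?thesis
      using 1 by (rule_tac has_field_derivative_transform_within_open[where S = "{0<..}"])
        (auto simp: flat_exp_def)
  next
    case 2
    have "((\<lambda>_. 0) has_real_derivative 0) (at s)" by simp
    then show ?thesis
      using 2 by (rule_tac has_field_derivative_transform_within_open[where S = "{..<0}" and f = "\<lambda>_. 0"])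
        (auto simp: flat_exp_def)
  next
    case 3
    \<comment> \<open>The difference quotient at 0 is itself a member of the family, so the
      derivative at 0 is the limit 0 already established.\<close>
    have "flat_exp n h / h = flat_exp (n + 1) h" for h
      by (simp add: flat_exp_def)
    then show ?thesis
      using flat_exp_tendsto_0[of "n + 1"] 3 flat_exp_def[of _ 0] by (simp add: DERIV_def)
  qed
qed

lemma smooth_flat_exp: "smooth (flat_exp n)"
proof -
  have "C_k k (flat_exp n)" for k
  proof (induction k arbitrary: n)
    case 0
    show ?case
      using flat_exp_deriv by (auto simp: continuous_on_eq_continuous_at intro: DERIV_isCont)
  next
    case (Suc k)
    have "C_k k (\<lambda>s. flat_exp (n + 2) s + - n * flat_exp (n + 1) s)"
      by (intro C_k_add C_k_mult C_k_const Suc)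
    then show ?case
      by (intro C_k_SucI[where h' = "\<lambda>s b. (flat_exp (n + 2) s - n * flat_exp (n + 1) s) * b"])
         (use flat_exp_deriv in \<open>auto simp: has_field_derivative_def\<close>)
  qed
  then show ?thesis by (simp add: smooth_def)
qed

text \<open>If M a < M b, test with a function that increases only just after a and decreases only just
  after b: there M is below, respectively above, the mean value of M a and M b.\<close>

lemma continuous_antimono_if_weak_derivative_le_0:
  fixes M :: "real \<Rightarrow> real"
  assumes cont: "continuous_on {0..T} M"
    and weak: "\<And>\<tau> \<tau>'. smooth \<tau> \<Longrightarrow> (\<And>t. (\<tau> has_real_derivative \<tau>' t) (at t)) \<Longrightarrow>
      continuous_on UNIV \<tau>' \<Longrightarrow> (\<And>t. 0 \<le> \<tau> t) \<Longrightarrow>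
      (\<exists>K. compact K \<and> K \<subseteq> {0<..<T} \<and> (\<forall>t. t \<notin> K \<longrightarrow> \<tau> t = 0)) \<Longrightarrow>
      0 \<le> (LINT t|time_measure T. M t * \<tau>' t)"
    and ab: "0 < a" "a < b" "b < T"
  shows "M b \<le> M a"
proof (rule ccontr)
  assume "\<not> M b \<le> M a"
  define c where "c = (M a + M b) / 2"
  have c: "M a < c" "c < M b" using \<open>\<not> M b \<le> M a\<close> by (auto simp: c_def)
  have isc: "isCont M a" "isCont M b"
    using cont ab continuous_on_interior[of "{0..T}" M] by auto
  have "eventually (\<lambda>t. M t < c) (nhds a)" "eventually (\<lambda>t. M t > c) (nhds b)"
    using order_tendstoD[of M "M a" "nhds a"] order_tendstoD[of M "M b" "nhds b"] isc c
    by (auto simp: isCont_def tendsto_at_iff_tendsto_nhds)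
  then obtain d1 d2 where d: "d1 > 0" "\<And>t. dist t a < d1 \<Longrightarrow> M t < c" "d2 > 0"
      "\<And>t. dist t b < d2 \<Longrightarrow> M t > c"
    unfolding eventually_nhds_metric by blast
  \<comment> \<open>Halving makes all bounds strict: the two bumps of width \<delta> to the right of
    \<open>a\<close> and \<open>b\<close> stay where M is compared with \<open>c\<close>, do not
    overlap, and end before T.\<close>
  define \<delta> where "\<delta> = min (min d1 d2) (min (b - a) (T - b)) / 2"
  have \<delta>: "\<delta> > 0" "\<delta> < d1" "\<delta> < d2" "\<delta> < b - a" "\<delta> < T - b"
    using d ab by (auto simp: \<delta>_def)
  define \<eta> where "\<eta> t = flat_exp 0 t * flat_exp 0 (\<delta> - t)" for t
  have \<eta>_smooth: "smooth \<eta>"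
    unfolding \<eta>_def
    by (intro smooth_mult smooth_flat_exp smooth_compose[OF smooth_flat_exp] smooth_diff
        smooth_const smooth_linear bounded_linear_ident)
  have \<eta>_nn: "\<eta> t \<ge> 0" for t by (auto simp: \<eta>_def flat_exp_def)
  have \<eta>_0: "\<eta> t = 0" if "t \<le> 0 \<or> t \<ge> \<delta>" for t using that by (auto simp: \<eta>_def flat_exp_def)
  have \<eta>_pos: "\<eta> t > 0" if "0 < t" "t < \<delta>" for t using that by (auto simp: \<eta>_def flat_exp_def)
  note \<eta>_cont = smooth_continuous[OF \<eta>_smooth]
  \<comment> \<open>The lower limit -1 lies to the left of the support of \<eta>, so the point 0 is
    interior and the derivative there is two-sided; further to the left N vanishes
    identically.\<close>
  define N where "N t = integral {-1..t} \<eta>" for t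
  have N_deriv: "(N has_real_derivative \<eta> t) (at t)" for t
  proof (cases "t > -1")
    case True
    have "(N has_real_derivative \<eta> t) (at t within {-1..t+1})"
      unfolding N_def
      by (rule integral_has_real_derivative) (use True \<eta>_cont continuous_on_subset in auto)
    then show ?thesis
      using True at_within_Icc_at[of "-1" t "t+1"] by simp
  next
    case False
    have "N s = 0" if "s < 0" for s
      unfolding N_def using that \<eta>_0 by (intro integral_unique has_integral_is_0) auto
    then have "((\<lambda>_. 0) has_real_derivative 0) (at t) \<longleftrightarrow> (N has_real_derivative 0) (at t)"
      using False by (intro DERIV_cong_ev) (auto simp: eventually_nhds intro!: exI[of _ "{..<0}"])
    then show ?thesis using False \<eta>_0 by simp
  qed
  have N_mono: "N s \<le> N t" if "s \<le> t" for s t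
    using DERIV_nonneg_imp_nondecreasing[OF that, of N] N_deriv \<eta>_nn by blast
  have N_lo: "N t = 0" if "t \<le> 0" for t
    unfolding N_def using that \<eta>_0 by (intro integral_unique has_integral_is_0) auto
  have N_hi: "N t = N \<delta>" if "t \<ge> \<delta>" for t
  proof (cases "t = \<delta>")
    case False
    with that have "\<delta> < t" by simp
    then have "\<exists>z. z > \<delta> \<and> z < t \<and> N t - N \<delta> = (t - \<delta>) * \<eta> z"
      using MVT2[of \<delta> t N \<eta>] N_deriv by blast
    then show ?thesis using \<eta>_0 by auto
  qed simp
  define \<tau> where "\<tau> t = N (t - a) - N (t - b)" for t
  define \<tau>' where "\<tau>' t = \<eta> (t - a) - \<eta> (t - b)" for t
  have \<tau>_deriv: "(\<tau> has_real_derivative \<tau>' t) (at t)" for t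
    unfolding \<tau>_def \<tau>'_def
    by (auto intro!: derivative_eq_intros DERIV_chain'[OF _ N_deriv, of _ 1, simplified])
  have \<tau>'_smooth: "smooth \<tau>'"
    unfolding \<tau>'_def
    by (intro smooth_compose[OF \<eta>_smooth] smooth_diff smooth_const smooth_linear bounded_linear_ident)
  have \<tau>_smooth: "smooth \<tau>" by (rule smooth_antiderivative[OF \<tau>_deriv \<tau>'_smooth])
  have \<tau>_supp: "\<tau> t = 0" if "t \<notin> {a..b + \<delta>}" for t
    using that N_lo[of "t - a"] N_lo[of "t - b"] N_hi[of "t - a"] N_hi[of "t - b"] ab \<delta>
    by (cases "t < a") (auto simp: \<tau>_def)
  note \<tau>'_cont = smooth_continuous[OF \<tau>'_smooth]
  have "0 \<le> (LINT t|time_measure T. M t * \<tau>' t)"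
  proof (rule weak[OF \<tau>_smooth \<tau>_deriv \<tau>'_cont])
    show "0 \<le> \<tau> t" for t using N_mono[of "t - b" "t - a"] ab by (simp add: \<tau>_def)
    show "\<exists>K. compact K \<and> K \<subseteq> {0<..<T} \<and> (\<forall>t. t \<notin> K \<longrightarrow> \<tau> t = 0)"
      using \<tau>_supp ab \<delta> by (intro exI[of _ "{a..b + \<delta>}"]) auto
  qed
  moreover have "(LINT t|time_measure T. M t * \<tau>' t) = integral {0..T} (\<lambda>t. M t * \<tau>' t)"
  proof -
    have "set_integrable lborel {0..T} (\<lambda>t. M t * \<tau>' t)"
      by (intro borel_integrable_atLeastAtMost' continuous_on_mult cont
          continuous_on_subset[OF \<tau>'_cont]) auto
    note set_borel_integral_eq_integral(2)[OF this]
    moreover have "(LINT t|time_measure T. M t * \<tau>' t) = (LINT t:{0..T}|lborel. M t * \<tau>' t)"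
      unfolding time_measure_def set_lebesgue_integral_def by (rule integral_restrict_space) simp
    ultimately show ?thesis by simp
  qed
  ultimately have M_ge: "0 \<le> integral {0..T} (\<lambda>t. M t * \<tau>' t)" by linarith
  have ints: "(\<lambda>t. M t * \<tau>' t) integrable_on {0..T}" "(\<lambda>t. c * \<tau>' t) integrable_on {0..T}"
    by (intro integrable_continuous_real continuous_on_mult cont
        continuous_on_subset[OF \<tau>'_cont] continuous_on_const; simp)+
  have "(\<tau>' has_integral (\<tau> T - \<tau> 0)) {0..T}"
  proof (rule fundamental_theorem_of_calculus)
    show "(\<tau> has_vector_derivative \<tau>' t) (at t within {0..T})" for t
      using \<tau>_deriv[of t] has_vector_derivative_at_within
      unfolding has_real_derivative_iff_has_vector_derivative by blast
  qed (use ab in simp)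
  moreover have "\<tau> T - \<tau> 0 = 0"
    using \<tau>_supp[of 0] \<tau>_supp[of T] ab \<delta> by simp
  ultimately have c_eq: "integral {0..T} (\<lambda>t. c * \<tau>' t) = 0"
    by (simp add: integral_unique)
  \<comment> \<open>Since \<tau>' has integral 0, replacing M by M - c does not change the integral
    against \<tau>'. The integrand D is nonnegative by the choice of the two bumps, while
    \<open>weak\<close> makes its integral nonpositive; continuity then forces D = 0, which fails at
    the midpoint of the first bump.\<close>
  define D where "D t = (c - M t) * \<tau>' t" for t
  have D_nn: "D t \<ge> 0" for t
  proof (cases "\<eta> (t - a) = 0")
    case False
    then have "0 < t - a" "t - a < \<delta>" using \<eta>_0[of "t - a"] by force+
    then have "M t < c" "\<eta> (t - b) = 0"
      using d(2)[of t] \<eta>_0[of "t - b"] \<delta> ab by (auto simp: dist_real_def)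
    then show ?thesis using \<eta>_nn by (simp add: D_def \<tau>'_def)
  next
    case True
    show ?thesis
    proof (cases "\<eta> (t - b) = 0")
      case False
      then have "0 < t - b" "t - b < \<delta>" using \<eta>_0[of "t - b"] by force+
      then have "M t > c" using d(4)[of t] \<delta> by (auto simp: dist_real_def)
      then show ?thesis using True \<eta>_nn[of "t - b"] by (simp add: D_def \<tau>'_def mult_nonpos_nonneg)
    qed (use True in \<open>simp add: D_def \<tau>'_def\<close>)
  qed
  have D_eq: "D = (\<lambda>t. c * \<tau>' t - M t * \<tau>' t)" by (simp add: D_def fun_eq_iff algebra_simps)
  have "integral {0..T} D = integral {0..T} (\<lambda>t. c * \<tau>' t) - integral {0..T} (\<lambda>t. M t * \<tau>' t)"
    unfolding D_eq by (rule integral_diff[OF ints(2,1)])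
  then have "integral {0..T} D \<le> 0" using M_ge c_eq by linarith
  moreover have "integral {0..T} D \<ge> 0"
    using integrable_diff[OF ints(2,1)] D_nn by (intro integral_nonneg) (simp_all flip: D_eq)
  moreover have "continuous_on {0..T} D"
    unfolding D_def by (intro continuous_on_mult continuous_on_diff continuous_on_const cont
        continuous_on_subset[OF \<tau>'_cont]) simp
  ultimately have "D (a + \<delta> / 2) = 0"
    using integral_eq_0_iff[of 0 T D] D_nn ab \<delta> by auto
  moreover have "M (a + \<delta> / 2) < c"
    using d(2) \<delta> by (auto simp: dist_real_def)
  moreover have "\<tau>' (a + \<delta> / 2) > 0"
    using \<eta>_pos[of "\<delta> / 2"] \<eta>_0[of "a + \<delta> / 2 - b"] \<delta> by (simp add: \<tau>'_def)
  ultimately show False by (simp add: D_def)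
qed

section \<open>The surface measure in polar coordinates\<close>

lemma sets_sphere_measure [measurable_cong]:
  "sets sphere_measure = sets (restrict_space borel (sphere 0 1))"
  by (simp add: sphere_measure_def)

lemma space_sphere_measure: "space sphere_measure = sphere 0 1"
  by (simp add: sphere_measure_def space_scale_measure space_restrict_space)

lemma measurable_sphere_measure_borel:
  "F \<in> M \<rightarrow>\<^sub>M sphere_measure \<Longrightarrow> F \<in> borel_measurable M"
  by (rule measurable_compose[of F M sphere_measure "\<lambda>x. x"])
     (simp_all add: measurable_cong_sets[OF sets_sphere_measure refl] measurable_restrict_space1)

lemma emeasure_sphere_measure:
  fixes E :: "(real ^ 'd) set"
  assumes "E \<in> sets sphere_measure"
  shows "emeasure sphere_measure E =
    of_nat CARD('d) * emeasure lborel {z. norm z < 1 \<and> z \<noteq> 0 \<and> sgn z \<in> E}"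
proof -
  let ?R = "restrict_space lborel (ball 0 1 - {0}) :: (real ^ 'd) measure"
  have sgn: "sgn \<in> ?R \<rightarrow>\<^sub>M restrict_space borel (sphere 0 1)"
    by (intro measurable_restrict_space2 measurable_restrict_space1)
       (auto simp: space_restrict_space norm_sgn)
  have "emeasure sphere_measure E = of_nat CARD('d) * emeasure ?R (sgn -` E \<inter> space ?R)"
    using assms sgn by (simp add: sphere_measure_def emeasure_distr)
  also have "emeasure ?R (sgn -` E \<inter> space ?R) = emeasure lborel (sgn -` E \<inter> space ?R)"
    by (rule emeasure_restrict_space) (auto simp: space_restrict_space)
  also have "sgn -` E \<inter> space ?R = {z. norm z < 1 \<and> z \<noteq> 0 \<and> sgn z \<in> E}"
    by (auto simp: space_restrict_space)
  finally show ?thesis .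
qed

lemma finite_measure_sphere_measure: "finite_measure (sphere_measure :: (real ^ 'd) measure)"
proof
  have "emeasure (lborel :: (real ^ 'd) measure) {z. norm z < 1 \<and> z \<noteq> 0 \<and> sgn z \<in> sphere 0 1}
      \<le> emeasure lborel (ball 0 1 :: (real ^ 'd) set)"
    by (rule emeasure_mono) auto
  also have "\<dots> < \<infinity>" by (rule emeasure_lborel_ball_finite)
  finally show "emeasure sphere_measure (space sphere_measure :: (real ^ 'd) set) \<noteq> \<infinity>"
    using emeasure_sphere_measure[OF sets.top, where 'd = 'd]
    by (simp add: space_sphere_measure ennreal_mult_eq_top_iff ennreal_of_nat_eq_real_of_nat)
qed

interpretation sphere: finite_measure sphere_measure
  by (rule finite_measure_sphere_measure)

text \<open>The value at 0 is an arbitrary unit vector, so that the map goes into the sphere.\<close>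

definition direction :: "real ^ 'd \<Rightarrow> real ^ 'd" where
  "direction z = (if z = 0 then axis undefined 1 else sgn z)"

lemma norm_direction [simp]: "norm (direction z) = 1"
  by (simp add: direction_def norm_sgn norm_axis_1)

lemma direction_scaleR: "r > 0 \<Longrightarrow> direction (r *\<^sub>R z) = direction z"
  by (simp add: direction_def sgn_scaleR)

lemma norm_scaleR_direction: "norm z *\<^sub>R direction z = z"
  by (simp add: direction_def sgn_div_norm)

lemma measurable_direction [measurable]: "direction \<in> borel \<rightarrow>\<^sub>M sphere_measure"
proof -
  have "direction \<in> borel \<rightarrow>\<^sub>M restrict_space borel (sphere 0 1)"
    unfolding direction_def[abs_def]
    by (intro measurable_restrict_space2 measurable_If) (auto simp: norm_sgn norm_axis_1)
  then show ?thesis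
    by (simp add: measurable_cong_sets[OF refl sets_sphere_measure])
qed

text \<open>Cones over E are invariant under dilation, and dilation by r multiplies Lebesgue measure
  by r^d. For r = 1 this is the definition of the surface measure, except at the null point 0, where
  \<open>direction\<close> and \<open>sgn\<close> differ.\<close>

lemma emeasure_ball_direction:
  fixes E :: "(real ^ 'd) set"
  assumes E: "E \<in> sets sphere_measure" and r: "r > 0"
  shows "of_nat CARD('d) * emeasure lborel {z. norm z < r \<and> direction z \<in> E} =
    ennreal (r ^ CARD('d)) * emeasure sphere_measure E"
proof -
  have meas: "{z. norm z < s \<and> direction z \<in> E} \<in> sets borel" for s
  proof -
    have "{z. norm z < s \<and> direction z \<in> E} = {z. norm z < s} \<inter> (direction -` E \<inter> space borel)"
      by auto
    moreover have "direction -` E \<inter> space borel \<in> sets borel"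
      by (rule measurable_sets[OF measurable_direction E])
    moreover have "{z :: real ^ 'd. norm z < s} \<in> sets borel" by measurable
    ultimately show ?thesis by auto
  qed
  have "emeasure lborel {z. norm z < r \<and> direction z \<in> E} =
      emeasure (density (distr lborel borel (\<lambda>x. 0 + r *\<^sub>R x)) (\<lambda>_. \<bar>r\<bar> ^ DIM(real ^ 'd)))
        {z. norm z < r \<and> direction z \<in> E}"
    using r lborel_affine[of r "0 :: real ^ 'd"] by simp
  also have "\<dots> = ennreal (r ^ CARD('d)) * emeasure lborel
      ((\<lambda>x. r *\<^sub>R x) -` {z. norm z < r \<and> direction z \<in> E})"
    using r meas[of r] by (subst emeasure_density_const) (auto simp: emeasure_distr)
  also have "(\<lambda>x. r *\<^sub>R x) -` {z. norm z < r \<and> direction z \<in> E} =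
      {z. norm z < 1 \<and> direction z \<in> E}"
    using r by (auto simp: direction_scaleR)
  also have "emeasure lborel {z. norm z < 1 \<and> direction z \<in> E} =
      emeasure lborel {z. norm z < 1 \<and> z \<noteq> 0 \<and> sgn z \<in> E}"
  proof (rule emeasure_eq_AE)
    show "AE z in lborel. z \<in> {z. norm z < 1 \<and> direction z \<in> E} \<longleftrightarrow>
        z \<in> {z. norm z < 1 \<and> z \<noteq> 0 \<and> sgn z \<in> E}"
      using AE_lborel_singleton[of 0] by eventually_elim (auto simp: direction_def)
    have "{z. norm z < 1 \<and> z \<noteq> 0 \<and> sgn z \<in> E} = {z. norm z < 1 \<and> direction z \<in> E} - {0}"
      by (auto simp: direction_def)
    then show "{z. norm z < 1 \<and> z \<noteq> 0 \<and> sgn z \<in> E} \<in> sets lborel"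
      using meas[of 1] by auto
  qed (use meas in simp)
  finally show ?thesis
    by (simp add: emeasure_sphere_measure[OF E] mult.left_commute)
qed

text \<open>This says that norm and direction are independent under Lebesgue measure. The image of
  Lebesgue measure under the norm plays the part of the radial measure, which spares computing the
  density r^(d-1) up to a constant.\<close>

lemma polar_decomposition:
  "distr (lborel :: (real ^ 'd) measure) borel norm \<Otimes>\<^sub>M (sphere_measure :: (real ^ 'd) measure) =
   scale_measure (emeasure sphere_measure (sphere 0 1 :: (real ^ 'd) set))
     (distr lborel (borel \<Otimes>\<^sub>M sphere_measure) (\<lambda>z. (norm z, direction z)))"
  (is "?N \<Otimes>\<^sub>M ?S = scale_measure ?c ?D")
proof (rule pair_measure_eqI)
  let ?L = "lborel :: (real ^ 'd) measure"
  have sphere_sets: "sphere 0 1 \<in> sets ?S"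
    using sets.top[of ?S] by (simp add: space_sphere_measure)
  have N_eq: "emeasure ?N {..<r} = emeasure ?L (ball 0 r)" for r
  proof -
    have "norm -` {..<r} = ball (0 :: real ^ 'd) r" by auto
    then show ?thesis by (simp add: emeasure_distr)
  qed
  show "sigma_finite_measure ?N"
  proof
    show "\<exists>A::real set set. countable A \<and> A \<subseteq> sets ?N \<and> \<Union>A = space ?N \<and> (\<forall>a\<in>A. emeasure ?N a \<noteq> \<infinity>)"
      using N_eq emeasure_lborel_ball_finite[where 'a = "real ^ 'd"]
      by (intro exI[of _ "range (\<lambda>n::nat. {..<real n})"])
         (auto simp: less_top[symmetric] intro: reals_Archimedean2)
  qed
  show "sigma_finite_measure ?S" ..
  show "sets (?N \<Otimes>\<^sub>M ?S) = sets (scale_measure ?c ?D)"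
    by (simp cong: sets_pair_measure_cong)
  fix A :: "real set" and E :: "(real ^ 'd) set"
  assume "A \<in> sets ?N" and E: "E \<in> sets ?S"
  then have A: "A \<in> sets borel" by simp
  have [measurable]: "direction -` E \<in> sets borel"
    using measurable_sets[OF measurable_direction E] by simp
  \<comment> \<open>For fixed E both sides of the product formula are measures in A. They are finite
    on half-lines, so it is enough to compare them there, where they become volumes of balls and of
    truncated cones.\<close>
  let ?M1 = "scale_measure (emeasure ?S E) ?N"
  let ?M2 = "scale_measure ?c (distr (density ?L (indicator (direction -` E))) borel norm)"
  have M2: "emeasure ?M2 X = ?c * emeasure lborel {z. norm z \<in> X \<and> direction z \<in> E}"
    if "X \<in> sets borel" for X
  proof -
    have [measurable]: "norm -` X \<in> sets (borel :: (real ^ 'd) measure)"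
      using measurable_sets[OF borel_measurable_norm that] by simp
    have "emeasure (distr (density ?L (indicator (direction -` E))) borel norm) X =
        emeasure (density ?L (indicator (direction -` E))) (norm -` X)"
      using that by (simp add: emeasure_distr)
    also have "\<dots> = emeasure ?L (direction -` E \<inter> norm -` X)"
      by (rule emeasure_restricted) simp_all
    also have "direction -` E \<inter> norm -` X = {z. norm z \<in> X \<and> direction z \<in> E}"
      by auto
    finally show ?thesis by simp
  qed
  have "?M1 = ?M2"
  proof (rule measure_eqI_generator_eq[where \<Omega> = UNIV and E = "range lessThan"
        and A = "\<lambda>n. {..<real n}"])
    show "Int_stable (range (lessThan :: real \<Rightarrow> _))"
    proof (rule Int_stableI)
      fix a b assume "a \<in> range (lessThan :: real \<Rightarrow> _)" "b \<in> range (lessThan :: real \<Rightarrow> _)"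
      then obtain x y where "a = {..<x}" "b = {..<y}" by auto
      then have "a \<inter> b = {..<min x y}" by auto
      then show "a \<inter> b \<in> range lessThan" by blast
    qed
    show "sets ?M1 = sigma_sets UNIV (range lessThan)" "sets ?M2 = sigma_sets UNIV (range lessThan)"
      by (simp_all add: borel_Iio)
    show "(\<Union>i. {..<real i}) = UNIV" by (auto intro: reals_Archimedean2)
    show "emeasure ?M1 {..<real i} \<noteq> \<infinity>" for i
      using N_eq[of "real i"] emeasure_lborel_ball_finite[of "0 :: real ^ 'd" "real i"]
        sphere.emeasure_finite[of E]
      by (simp add: ennreal_mult_eq_top_iff)
    fix X :: "real set" assume "X \<in> range lessThan"
    then obtain r where X: "X = {..<r}" by auto
    have "X \<in> sets borel" by (simp add: X)
    have "emeasure ?M1 X = ?c * emeasure lborel {z. norm z \<in> X \<and> direction z \<in> E}"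
    proof (cases "r > 0")
      case False
      then have "\<not> norm z < r" for z :: "real ^ 'd"
        using norm_ge_zero[of z] by linarith
      then show ?thesis using False N_eq[of r] ball_empty[of r "0 :: real ^ 'd"] by (simp add: X)
    next
      case True
      let ?a = "emeasure lborel {z. norm z < r \<and> direction z \<in> E}"
      let ?b = "emeasure ?L (ball 0 r)"
      let ?d = "of_nat CARD('d) :: ennreal"
      have "?d * ?b = ennreal (r ^ CARD('d)) * ?c"
        using emeasure_ball_direction[OF sphere_sets True] by (simp add: ball_def dist_norm)
      moreover have "?d * ?a = ennreal (r ^ CARD('d)) * emeasure ?S E"
        by (rule emeasure_ball_direction[OF E True])
      \<comment> \<open>The ball and the truncated cone scale with the same r^d, so
        cross-multiplying makes both sides agree; only the dimension has to be cancelled.\<close>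
      ultimately have "?d * (emeasure ?S E * ?b) = ?d * (?c * ?a)"
        by (metis (no_types, lifting) mult.assoc mult.commute)
      then have "emeasure ?S E * ?b = ?c * ?a"
        by (subst (asm) ennreal_mult_cancel_left) (auto simp: ennreal_of_nat_eq_real_of_nat)
      then show ?thesis using N_eq[of r] by (simp add: X)
    qed
    then show "emeasure ?M1 X = emeasure ?M2 X"
      unfolding M2[OF \<open>X \<in> sets borel\<close>] .
  qed auto
  then have "emeasure ?N A * emeasure ?S E = ?c * emeasure lborel {z. norm z \<in> A \<and> direction z \<in> E}"
    using M2[OF A] by (metis emeasure_scale_measure mult.commute)
  also have "emeasure lborel {z. norm z \<in> A \<and> direction z \<in> E} = emeasure ?D (A \<times> E)"
    using A E by (subst emeasure_distr) (auto intro!: arg_cong[where f = "emeasure lborel"])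
  finally show "emeasure ?N A * emeasure ?S E = emeasure (scale_measure ?c ?D) (A \<times> E)"
    by simp
qed

text \<open>Writing z = r \<omega>, both sides integrate over r, \<omega> and \<sigma>, with the
  same surface measure for \<omega> and \<sigma>. The integrands differ only by exchanging the two
  unit vectors.\<close>

lemma nn_integral_exchange_directions:
  fixes G :: "(real ^ 'd) \<times> (real ^ 'd) \<Rightarrow> ennreal"
  assumes G [measurable]: "G \<in> borel_measurable (borel \<Otimes>\<^sub>M sphere_measure)"
  shows "(\<integral>\<^sup>+z. \<integral>\<^sup>+\<sigma>. G (norm z *\<^sub>R \<sigma>, direction z) \<partial>sphere_measure \<partial>lborel) =
    (\<integral>\<^sup>+z. \<integral>\<^sup>+\<sigma>. G (z, \<sigma>) \<partial>sphere_measure \<partial>lborel)"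
proof -
  let ?S = "sphere_measure :: (real ^ 'd) measure"
  let ?N = "distr (lborel :: (real ^ 'd) measure) borel norm"
  let ?c = "emeasure ?S (sphere 0 1)"
  have "?c = of_nat CARD('d) * emeasure lborel (ball 0 1 :: (real ^ 'd) set)"
    using emeasure_ball_direction[of "sphere 0 1 :: (real ^ 'd) set" 1] sets.top[of ?S]
    by (simp add: space_sphere_measure ball_def dist_norm)
  moreover have "emeasure lborel (ball 0 1 :: (real ^ 'd) set) \<noteq> 0"
    using open_not_negligible[of "ball 0 1 :: (real ^ 'd) set"]
    by (auto simp: negligible_iff_null_sets null_sets_def)
  \<comment> \<open>The polar formula carries the total mass of the sphere as a factor; being
    neither 0 nor infinite, it can be cancelled at the end.\<close>
  ultimately have c0: "?c \<noteq> 0" by simp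
  have c1: "?c \<noteq> \<infinity>" using sphere.emeasure_finite by simp
  have polar: "?c * (\<integral>\<^sup>+z. H (norm z, direction z) \<partial>lborel) = (\<integral>\<^sup>+r. \<integral>\<^sup>+\<omega>. H (r, \<omega>) \<partial>?S \<partial>?N)"
    if [measurable]: "H \<in> borel_measurable (borel \<Otimes>\<^sub>M ?S)" for H
  proof -
    have "(\<integral>\<^sup>+r. \<integral>\<^sup>+\<omega>. H (r, \<omega>) \<partial>?S \<partial>?N) = integral\<^sup>N (?N \<Otimes>\<^sub>M ?S) H"
      by (rule sphere.nn_integral_fst) simp
    also have "\<dots> = ?c * (\<integral>\<^sup>+z. H (norm z, direction z) \<partial>lborel)"
      unfolding polar_decomposition by (simp add: nn_integral_scale_measure nn_integral_distr)
    finally show ?thesis by simp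
  qed
  note [measurable (raw)] = measurable_sphere_measure_borel
  have [measurable]: "snd \<in> borel_measurable (M \<Otimes>\<^sub>M ?S)" for M :: "'b measure"
    by (rule measurable_sphere_measure_borel) simp
  interpret SS: pair_sigma_finite ?S ?S ..
  have "?c * (\<integral>\<^sup>+z. \<integral>\<^sup>+\<sigma>. G (norm z *\<^sub>R \<sigma>, direction z) \<partial>?S \<partial>lborel) =
      (\<integral>\<^sup>+r. \<integral>\<^sup>+\<omega>. \<integral>\<^sup>+\<sigma>. G (r *\<^sub>R \<sigma>, \<omega>) \<partial>?S \<partial>?S \<partial>?N)"
    using polar[of "\<lambda>(r, \<omega>). \<integral>\<^sup>+\<sigma>. G (r *\<^sub>R \<sigma>, \<omega>) \<partial>?S"] by simp
  \<comment> \<open>Tonelli on the product of the sphere with itself is the actual exchange of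
    directions.\<close>
  also have "\<dots> = (\<integral>\<^sup>+r. \<integral>\<^sup>+\<sigma>. \<integral>\<^sup>+\<omega>. G (r *\<^sub>R \<sigma>, \<omega>) \<partial>?S \<partial>?S \<partial>?N)"
    by (intro nn_integral_cong SS.Fubini') simp
  also have "\<dots> = ?c * (\<integral>\<^sup>+z. \<integral>\<^sup>+\<sigma>. G (norm z *\<^sub>R direction z, \<sigma>) \<partial>?S \<partial>lborel)"
    using polar[of "\<lambda>(r, \<omega>). \<integral>\<^sup>+\<sigma>. G (r *\<^sub>R \<omega>, \<sigma>) \<partial>?S"] by simp
  finally show ?thesis
    using c0 c1 by (simp add: norm_scaleR_direction ennreal_mult_cancel_left)
qed

section \<open>The collision change of variables\<close>

lemma nn_integral_lborel_translate:
  fixes F :: "'a :: euclidean_space \<Rightarrow> ennreal"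
  assumes "F \<in> borel_measurable borel"
  shows "(\<integral>\<^sup>+x. F (a + x) \<partial>lborel) = (\<integral>\<^sup>+x. F x \<partial>lborel)"
proof -
  have "(\<integral>\<^sup>+x. F x \<partial>lborel) = (\<integral>\<^sup>+x. F x \<partial>distr lborel borel ((+) a))"
    by (simp add: lborel_distr_plus)
  also have "\<dots> = (\<integral>\<^sup>+x. F (a + x) \<partial>lborel)"
    using assms by (intro nn_integral_distr) auto
  finally show ?thesis by simp
qed

text \<open>The substitution v = c + z/2, w = c - z/2 has Jacobian of modulus 1. It splits into two
  translations, v = w + z at fixed w and then w = c - z/2 at fixed z, with Tonelli in between, so no
  determinant appears.\<close>

lemma nn_integral_center_of_mass:
  fixes F :: "'a :: euclidean_space \<times> 'a \<Rightarrow> ennreal"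
  assumes F [measurable]: "F \<in> borel_measurable (borel \<Otimes>\<^sub>M borel)"
  shows "(\<integral>\<^sup>+v. \<integral>\<^sup>+w. F (v, w) \<partial>lborel \<partial>lborel) =
    (\<integral>\<^sup>+z. \<integral>\<^sup>+c. F (c + (1 / 2) *\<^sub>R z, c - (1 / 2) *\<^sub>R z) \<partial>lborel \<partial>lborel)"
proof -
  have "(\<integral>\<^sup>+v. \<integral>\<^sup>+w. F (v, w) \<partial>lborel \<partial>lborel) = (\<integral>\<^sup>+w. \<integral>\<^sup>+v. F (v, w) \<partial>lborel \<partial>lborel)"
    by (rule lborel_pair.Fubini'[symmetric]) simp
  also have "\<dots> = (\<integral>\<^sup>+w. \<integral>\<^sup>+z. F (w + z, w) \<partial>lborel \<partial>lborel)"
    by (intro nn_integral_cong nn_integral_lborel_translate[symmetric]) measurable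
  also have "\<dots> = (\<integral>\<^sup>+z. \<integral>\<^sup>+w. F (w + z, w) \<partial>lborel \<partial>lborel)"
    by (rule lborel_pair.Fubini') simp
  also have "\<dots> = (\<integral>\<^sup>+z. \<integral>\<^sup>+c. F (- ((1 / 2) *\<^sub>R z) + c + z, - ((1 / 2) *\<^sub>R z) + c) \<partial>lborel \<partial>lborel)"
    by (intro nn_integral_cong nn_integral_lborel_translate[symmetric]) measurable
  also have "\<dots> = (\<integral>\<^sup>+z. \<integral>\<^sup>+c. F (c + (1 / 2) *\<^sub>R z, c - (1 / 2) *\<^sub>R z) \<partial>lborel \<partial>lborel)"
  proof -
    have eq: "- ((1 / 2) *\<^sub>R z) + c + z = c + (1 / 2) *\<^sub>R z" for z c :: 'a
    proof -
      have "- h + c + (h + h) = c + h" for h :: 'a by (simp add: algebra_simps)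
      from this[of "(1 / 2) *\<^sub>R z"] show ?thesis by (simp flip: scaleR_left_distrib)
    qed
    show ?thesis unfolding eq by simp
  qed
  finally show ?thesis .
qed

text \<open>For z = v - w and c the mean of v and w, a collision fixes c and sends (z, \<sigma>) to
  (|z| \<sigma>, z/|z|). After integrating out c this is the exchange of directions.\<close>

lemma nn_integral_collision:
  fixes K :: "(real ^ 'd) \<times> (real ^ 'd) \<times> (real ^ 'd) \<Rightarrow> ennreal"
  assumes K [measurable]: "K \<in> borel_measurable (borel \<Otimes>\<^sub>M borel \<Otimes>\<^sub>M sphere_measure)"
  shows "(\<integral>\<^sup>+v. \<integral>\<^sup>+w. \<integral>\<^sup>+\<sigma>. K (post_v v w \<sigma>, post_w v w \<sigma>, direction (v - w))
      \<partial>sphere_measure \<partial>lborel \<partial>lborel) =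
    (\<integral>\<^sup>+v. \<integral>\<^sup>+w. \<integral>\<^sup>+\<sigma>. K (v, w, \<sigma>) \<partial>sphere_measure \<partial>lborel \<partial>lborel)"
proof -
  let ?S = "sphere_measure :: (real ^ 'd) measure"
  have [measurable]: "snd \<in> borel_measurable (M \<Otimes>\<^sub>M ?S)" for M :: "'b measure"
    by (rule measurable_sphere_measure_borel) simp
  interpret LS: pair_sigma_finite "lborel :: (real ^ 'd) measure" ?S ..
  let ?k = "\<lambda>y c \<omega>. K (c + (1 / 2) *\<^sub>R y, c - (1 / 2) *\<^sub>R y, \<omega>)"
  let ?G = "\<lambda>(y, \<omega>). \<integral>\<^sup>+c. ?k y c \<omega> \<partial>lborel"
  have "(\<integral>\<^sup>+v. \<integral>\<^sup>+w. \<integral>\<^sup>+\<sigma>. K (post_v v w \<sigma>, post_w v w \<sigma>, direction (v - w)) \<partial>?S \<partial>lborel \<partial>lborel) =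
      (\<integral>\<^sup>+z. \<integral>\<^sup>+c. \<integral>\<^sup>+\<sigma>. ?k (norm z *\<^sub>R \<sigma>) c (direction z) \<partial>?S \<partial>lborel \<partial>lborel)"
  proof -
    have "(1 / 2) *\<^sub>R (c + (1 / 2) *\<^sub>R z + (c - (1 / 2) *\<^sub>R z)) = c"
      and "c + (1 / 2) *\<^sub>R z - (c - (1 / 2) *\<^sub>R z) = z" for z c :: "real ^ 'd"
      by (simp_all flip: scaleR_left_distrib)
    note half = this
    show ?thesis
      unfolding post_v_def post_w_def
      using nn_integral_center_of_mass[of "\<lambda>(v, w). \<integral>\<^sup>+\<sigma>. K ((1 / 2) *\<^sub>R (v + w) + (norm (v - w) / 2) *\<^sub>R \<sigma>,
          (1 / 2) *\<^sub>R (v + w) - (norm (v - w) / 2) *\<^sub>R \<sigma>, direction (v - w)) \<partial>?S"]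
      by (simp add: half)
  qed
  also have "\<dots> = (\<integral>\<^sup>+z. \<integral>\<^sup>+\<sigma>. ?G (norm z *\<^sub>R \<sigma>, direction z) \<partial>?S \<partial>lborel)"
    by (intro nn_integral_cong) (simp, intro LS.Fubini'[symmetric], measurable)
  also have "\<dots> = (\<integral>\<^sup>+z. \<integral>\<^sup>+\<sigma>. ?G (z, \<sigma>) \<partial>?S \<partial>lborel)"
    by (rule nn_integral_exchange_directions) measurable
  also have "\<dots> = (\<integral>\<^sup>+z. \<integral>\<^sup>+c. \<integral>\<^sup>+\<sigma>. ?k z c \<sigma> \<partial>?S \<partial>lborel \<partial>lborel)"
    by (intro nn_integral_cong) (simp, intro LS.Fubini', measurable)
  also have "\<dots> = (\<integral>\<^sup>+v. \<integral>\<^sup>+w. \<integral>\<^sup>+\<sigma>. K (v, w, \<sigma>) \<partial>?S \<partial>lborel \<partial>lborel)"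
    using nn_integral_center_of_mass[of "\<lambda>(v, w). \<integral>\<^sup>+\<sigma>. K (v, w, \<sigma>) \<partial>?S"] by simp
  finally show ?thesis .
qed

section \<open>Collisions as a measure-preserving map of phase space\<close>

lemma torus_cell_borel: "torus_cell \<in> sets borel"
proof -
  have [measurable]: "(\<lambda>x :: real ^ 'd. x $ i) \<in> borel_measurable borel" for i
    by (intro borel_measurable_continuous_onI continuous_intros)
  show "(torus_cell :: (real ^ 'd) set) \<in> sets borel"
    unfolding torus_cell_def by measurable
qed

interpretation torus: sigma_finite_measure torus_measure
  unfolding torus_measure_def
  by (rule sigma_finite_measure_restrict_space) (simp_all add: lborel.sigma_finite_measure_axioms torus_cell_borel)

interpretation time: sigma_finite_measure "time_measure T" for T
  unfolding time_measure_def
  by (rule sigma_finite_measure_restrict_space) (simp_all add: lborel.sigma_finite_measure_axioms)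

interpretation vt: pair_sigma_finite lborel "time_measure T" for T ..

interpretation xvt: pair_sigma_finite torus_measure "lborel \<Otimes>\<^sub>M time_measure T" for T ..

interpretation xvt_space: sigma_finite_measure "xvt_measure T" for T
  unfolding xvt_measure_def ..

interpretation ws: pair_sigma_finite lborel sphere_measure ..

abbreviation ws_measure :: "((real ^ 'd) \<times> (real ^ 'd)) measure" where
  "ws_measure \<equiv> lborel \<Otimes>\<^sub>M sphere_measure"

interpretation collision_space: pair_sigma_finite "xvt_measure T" ws_measure for T ..

text \<open>Recording the old direction of v - w as the new angular variable makes the map an
  involution on unit \<sigma> and v \<noteq> w, rather than a map that forgets \<sigma>. Position
  and time are mere parameters.\<close>

fun collide :: "'d::finite point \<times> (real ^ 'd) \<times> (real ^ 'd) \<Rightarrow> 'd point \<times> (real ^ 'd) \<times> (real ^ 'd)" where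
  "collide ((x, v, t), (w, \<sigma>)) = ((x, post_v v w \<sigma>, t), (post_w v w \<sigma>, direction (v - w)))"

lemma measurable_collide [measurable]:
  "collide \<in> xvt_measure T \<Otimes>\<^sub>M ws_measure \<rightarrow>\<^sub>M xvt_measure T \<Otimes>\<^sub>M ws_measure"
proof -
  have eq: "collide = (\<lambda>((x, v, t), (w, \<sigma>)). ((x, post_v v w \<sigma>, t), (post_w v w \<sigma>, direction (v - w))))"
    by (auto simp: fun_eq_iff)
  have [measurable]: "snd \<in> borel_measurable (M \<Otimes>\<^sub>M sphere_measure)" for M :: "'b measure"
    by (rule measurable_sphere_measure_borel) simp
  show ?thesis
    unfolding eq post_v_def post_w_def xvt_measure_def unfolding case_prod_unfold by measurable
qed

text \<open>This order of integration puts v, w and \<sigma> innermost, so that the collision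
  formula applies with x and t frozen.\<close>

lemma nn_integral_collision_space:
  assumes F [measurable]: "F \<in> borel_measurable (xvt_measure T \<Otimes>\<^sub>M ws_measure)"
  shows "integral\<^sup>N (xvt_measure T \<Otimes>\<^sub>M ws_measure) F =
    (\<integral>\<^sup>+x. \<integral>\<^sup>+t. \<integral>\<^sup>+v. \<integral>\<^sup>+w. \<integral>\<^sup>+\<sigma>. F ((x, v, t), (w, \<sigma>))
      \<partial>sphere_measure \<partial>lborel \<partial>lborel \<partial>time_measure T \<partial>torus_measure)"
proof -
  note [measurable] = F[unfolded xvt_measure_def]
  have "integral\<^sup>N (xvt_measure T \<Otimes>\<^sub>M ws_measure) F = (\<integral>\<^sup>+p. \<integral>\<^sup>+q. F (p, q) \<partial>ws_measure \<partial>xvt_measure T)"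
    by (rule ws.nn_integral_fst[symmetric]) simp
  also have "\<dots> = (\<integral>\<^sup>+x. \<integral>\<^sup>+y. \<integral>\<^sup>+q. F ((x, y), q) \<partial>ws_measure \<partial>(lborel \<Otimes>\<^sub>M time_measure T) \<partial>torus_measure)"
    unfolding xvt_measure_def by (rule vt.nn_integral_fst[symmetric]) measurable
  also have "\<dots> = (\<integral>\<^sup>+x. \<integral>\<^sup>+t. \<integral>\<^sup>+v. \<integral>\<^sup>+q. F ((x, v, t), q) \<partial>ws_measure \<partial>lborel \<partial>time_measure T \<partial>torus_measure)"
    by (intro nn_integral_cong vt.nn_integral_snd[symmetric]) measurable
  also have "\<dots> = (\<integral>\<^sup>+x. \<integral>\<^sup>+t. \<integral>\<^sup>+v. \<integral>\<^sup>+w. \<integral>\<^sup>+\<sigma>. F ((x, v, t), (w, \<sigma>))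
      \<partial>sphere_measure \<partial>lborel \<partial>lborel \<partial>time_measure T \<partial>torus_measure)"
    by (intro nn_integral_cong sphere.nn_integral_fst[symmetric]) (simp add: space_pair_measure)
  finally show ?thesis .
qed

lemma distr_collide:
  "distr (xvt_measure T \<Otimes>\<^sub>M ws_measure) (xvt_measure T \<Otimes>\<^sub>M ws_measure) collide =
    xvt_measure T \<Otimes>\<^sub>M ws_measure"
  (is "distr ?P ?P collide = ?P")
proof (rule measure_eqI)
  fix A assume "A \<in> sets (distr ?P ?P collide)"
  then have A: "A \<in> sets ?P" by simp
  let ?F = "indicator A :: _ \<Rightarrow> ennreal"
  have F: "?F \<in> borel_measurable ?P" using A by simp
  have "emeasure (distr ?P ?P collide) A = integral\<^sup>N (distr ?P ?P collide) ?F"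
    using A by (subst nn_integral_indicator) simp_all
  also have "\<dots> = (\<integral>\<^sup>+p. ?F (collide p) \<partial>?P)"
    by (rule nn_integral_distr) (use A in simp_all)
  also have "\<dots> = (\<integral>\<^sup>+x. \<integral>\<^sup>+t. \<integral>\<^sup>+v. \<integral>\<^sup>+w. \<integral>\<^sup>+\<sigma>. ?F (collide ((x, v, t), (w, \<sigma>)))
      \<partial>sphere_measure \<partial>lborel \<partial>lborel \<partial>time_measure T \<partial>torus_measure)"
    by (rule nn_integral_collision_space, rule measurable_compose[OF measurable_collide F])
  also have "\<dots> = (\<integral>\<^sup>+x. \<integral>\<^sup>+t. \<integral>\<^sup>+v. \<integral>\<^sup>+w. \<integral>\<^sup>+\<sigma>. ?F ((x, v, t), (w, \<sigma>))
      \<partial>sphere_measure \<partial>lborel \<partial>lborel \<partial>time_measure T \<partial>torus_measure)"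
  proof (rule nn_integral_cong, rule nn_integral_cong)
    fix x :: "real ^ 'a" and t
    assume x: "x \<in> space torus_measure" and t: "t \<in> space (time_measure T)"
    have "(\<lambda>(v, w, \<sigma>). ((x, v, t), (w, \<sigma>))) \<in> borel \<Otimes>\<^sub>M borel \<Otimes>\<^sub>M sphere_measure \<rightarrow>\<^sub>M ?P"
      using x t unfolding xvt_measure_def by simp
    from measurable_compose[OF this F] show "(\<integral>\<^sup>+v. \<integral>\<^sup>+w. \<integral>\<^sup>+\<sigma>. ?F (collide ((x, v, t), (w, \<sigma>)))
        \<partial>sphere_measure \<partial>lborel \<partial>lborel) =
      (\<integral>\<^sup>+v. \<integral>\<^sup>+w. \<integral>\<^sup>+\<sigma>. ?F ((x, v, t), (w, \<sigma>)) \<partial>sphere_measure \<partial>lborel \<partial>lborel)"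
      using nn_integral_collision[of "\<lambda>(v, w, \<sigma>). ?F ((x, v, t), (w, \<sigma>))"]
      by (simp add: case_prod_unfold)
  qed
  also have "\<dots> = integral\<^sup>N ?P ?F"
    by (rule nn_integral_collision_space[symmetric, OF F])
  also have "\<dots> = emeasure ?P A"
    using A by simp
  finally show "emeasure (distr ?P ?P collide) A = emeasure ?P A" .
qed simp

text \<open>At v = w the symmetry of the kernel says nothing and \<open>direction\<close> takes an
  arbitrary value, so gain and loss can be matched only off this set. For fixed v it is the single
  point w = v.\<close>

lemma AE_relative_velocity_nonzero:
  "AE p in xvt_measure T \<Otimes>\<^sub>M ws_measure. fst (snd (fst p)) - fst (snd p) \<noteq> 0"
proof (rule collision_space.AE_pair_measure)
  show "{p \<in> space (xvt_measure T \<Otimes>\<^sub>M ws_measure). fst (snd (fst p)) - fst (snd p) \<noteq> (0 :: real ^ 'a)}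
      \<in> sets (xvt_measure T \<Otimes>\<^sub>M ws_measure)"
    unfolding xvt_measure_def by measurable
  show "AE p in xvt_measure T. AE q in ws_measure. fst (snd (fst (p, q))) - fst (snd (p, q)) \<noteq> (0 :: real ^ 'a)"
  proof (rule AE_I2)
    fix p :: "'a point"
    show "AE q in ws_measure. fst (snd (fst (p, q))) - fst (snd (p, q)) \<noteq> (0 :: real ^ 'a)"
    proof (rule ws.AE_pair_measure)
      show "AE w in lborel. AE \<sigma> in sphere_measure. fst (snd (fst (p, (w, \<sigma>)))) - fst (snd (p, (w, \<sigma>))) \<noteq> (0 :: real ^ 'a)"
        using AE_lborel_singleton[of "fst (snd p)"] by eventually_elim auto
      have "{q \<in> space ws_measure. fst (snd p) - fst q \<noteq> 0} \<in> sets ws_measure"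
        by measurable
      then show "{q \<in> space ws_measure. fst (snd (fst (p, q))) - fst (snd (p, q)) \<noteq> 0} \<in> sets ws_measure"
        by simp
    qed
  qed
qed

lemma post_v_minus_post_w: "post_v v w \<sigma> - post_w v w \<sigma> = norm (v - w) *\<^sub>R \<sigma>"
  by (simp add: post_v_def post_w_def flip: scaleR_left_distrib)

text \<open>This is microreversibility: the new relative velocity |z| \<sigma> has norm |z|, and its
  angle with z/|z| is the angle between z and \<sigma>. The kernel depends on these two quantities
  only.\<close>

lemma loss_collide:
  assumes "collision_kernel B" "v \<noteq> w" "norm \<sigma> = 1"
  shows "case_prod (loss_integrand B f u) (collide ((x, v, t), (w, \<sigma>))) = gain_integrand B f u (x, v, t) (w, \<sigma>)"
proof -
  from assms(1) obtain b where b: "\<And>z \<sigma>. norm \<sigma> = 1 \<Longrightarrow> z \<noteq> 0 \<Longrightarrow> B z \<sigma> = b (norm z) (z \<bullet> \<sigma> / norm z)"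
    unfolding collision_kernel_def by auto
  let ?z = "v - w"
  have "norm ?z * (?z \<bullet> \<sigma>) / norm ?z = norm ?z * (\<sigma> \<bullet> direction ?z)"
    using assms(2) arg_cong[OF norm_scaleR_direction[of ?z], of "\<lambda>y. \<sigma> \<bullet> y"]
    by (simp add: inner_commute)
  moreover have "\<sigma> \<noteq> 0" using assms(3) by auto
  ultimately have "B (norm ?z *\<^sub>R \<sigma>) (direction ?z) = B ?z \<sigma>"
    using assms(2,3) b[of "direction ?z" "norm ?z *\<^sub>R \<sigma>"] b[of \<sigma> ?z] by (simp add: field_simps)
  then show ?thesis
    by (simp add: loss_integrand_def gain_integrand_def post_v_minus_post_w)
qed

lemma measurable_loss_integrand:
  assumes B: "collision_kernel B"
    and f: "f \<in> borel_measurable (xvt_measure T)" and u: "u \<in> borel_measurable (xvt_measure T)"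
  shows "case_prod (loss_integrand B f u) \<in> borel_measurable (xvt_measure T \<Otimes>\<^sub>M ws_measure)"
proof -
  have eq: "case_prod (loss_integrand B f u) = (\<lambda>((x, v, t), (w, \<sigma>)).
      f (x, w, t) * u (x, v, t) * (case (v - w, \<sigma>) of (z, \<sigma>) \<Rightarrow> B z \<sigma>))"
    by (auto simp: loss_integrand_def fun_eq_iff)
  have [measurable]: "(\<lambda>(z, \<sigma>). B z \<sigma>) \<in> borel_measurable (lborel \<Otimes>\<^sub>M sphere_measure)"
    using B by (simp add: collision_kernel_def)
  note [measurable] = f[unfolded xvt_measure_def] u[unfolded xvt_measure_def]
  show ?thesis unfolding eq xvt_measure_def unfolding case_prod_unfold by measurable
qed

lemma measurable_gain_integrand:
  assumes B: "collision_kernel B"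
    and f: "f \<in> borel_measurable (xvt_measure T)" and u: "u \<in> borel_measurable (xvt_measure T)"
  shows "case_prod (gain_integrand B f u) \<in> borel_measurable (xvt_measure T \<Otimes>\<^sub>M ws_measure)"
proof -
  have eq: "case_prod (gain_integrand B f u) = (\<lambda>((x, v, t), (w, \<sigma>)).
      f (x, post_w v w \<sigma>, t) * u (x, post_v v w \<sigma>, t) * (case (v - w, \<sigma>) of (z, \<sigma>) \<Rightarrow> B z \<sigma>))"
    by (auto simp: gain_integrand_def fun_eq_iff)
  have [measurable]: "snd \<in> borel_measurable (M \<Otimes>\<^sub>M sphere_measure)" for M :: "'b measure"
    by (rule measurable_sphere_measure_borel) simp
  have [measurable]: "(\<lambda>(z, \<sigma>). B z \<sigma>) \<in> borel_measurable (lborel \<Otimes>\<^sub>M sphere_measure)"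
    using B by (simp add: collision_kernel_def)
  note [measurable] = f[unfolded xvt_measure_def] u[unfolded xvt_measure_def]
  show ?thesis unfolding eq xvt_measure_def post_v_def post_w_def unfolding case_prod_unfold by measurable
qed

lemma integrable_mult_bounded:
  fixes F h :: "'a \<Rightarrow> real"
  assumes F: "integrable M F" and h: "h \<in> borel_measurable M" "\<And>p. \<bar>h p\<bar> \<le> C"
  shows "integrable M (\<lambda>p. F p * h p)"
proof (rule Bochner_Integration.integrable_bound)
  show "integrable M (\<lambda>p. F p * C)" using F by simp
  show "(\<lambda>p. F p * h p) \<in> borel_measurable M" using F h(1) by simp
  have "\<bar>F p\<bar> * \<bar>h p\<bar> \<le> \<bar>F p\<bar> * \<bar>C\<bar>" for p
    using h(2)[of p] by (intro mult_left_mono) auto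
  then show "AE p in M. norm (F p * h p) \<le> norm (F p * C)"
    by (simp add: abs_mult)
qed

text \<open>The gain integrand is almost everywhere the loss integrand after \<open>collide\<close>,
  and a weight depending on t alone does not see the collision. Integrability of the loss therefore
  passes to the gain, and their weighted integrals cancel.\<close>

lemma integral_Q_eq_0:
  assumes B: "collision_kernel B"
    and f: "f \<in> borel_measurable (xvt_measure T)" and u: "u \<in> borel_measurable (xvt_measure T)"
    and loss: "integrable (xvt_measure T \<Otimes>\<^sub>M ws_measure) (case_prod (loss_integrand B f u))"
    and \<tau>: "\<tau> \<in> borel_measurable borel" "\<And>t. \<bar>\<tau> t\<bar> \<le> C"
  shows "integrable (xvt_measure T) (Q B f u)"
    and "(LINT (x, v, t)|xvt_measure T. Q B f u (x, v, t) * \<tau> t) = 0"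
proof -
  let ?P = "xvt_measure T \<Otimes>\<^sub>M ws_measure :: ('a point \<times> (real ^ 'a) \<times> (real ^ 'a)) measure"
  let ?L = "case_prod (loss_integrand B f u)" and ?G = "case_prod (gain_integrand B f u)"
  let ?t = "\<lambda>p :: 'a point \<times> (real ^ 'a) \<times> (real ^ 'a). \<tau> (snd (snd (fst p)))"
  note [measurable] = measurable_loss_integrand[OF B f u]
  have [measurable]: "\<tau> \<in> borel_measurable (time_measure T)"
    using \<tau>(1) by (simp add: time_measure_def measurable_restrict_space1)
  have t_meas [measurable]: "?t \<in> borel_measurable ?P"
    unfolding xvt_measure_def by measurable
  have t_collide: "?t (collide p) = ?t p" for p
    by (cases p rule: collide.cases) simp
  have LG: "AE p in ?P. ?L (collide p) = ?G p"
    using AE_relative_velocity_nonzero AE_space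
  proof eventually_elim
    case (elim p)
    then show ?case
      by (cases p rule: collide.cases)
         (auto intro!: loss_collide[OF B] simp: space_pair_measure space_sphere_measure simp del: collide.simps)
  qed
  note [measurable] = measurable_gain_integrand[OF B f u]
  \<comment> \<open>Two invariant weights \<open>h\<close> are used: the constant 1, for
    integrability of the gain, and \<tau>, for the equality of the integrals.\<close>
  have G_int: "integrable ?P (\<lambda>p. ?G p * h p) \<longleftrightarrow> integrable ?P (\<lambda>p. ?L p * h p)" 
    and G_eq: "integral\<^sup>L ?P (\<lambda>p. ?G p * h p) = integral\<^sup>L ?P (\<lambda>p. ?L p * h p)"
    if [measurable]: "h \<in> borel_measurable ?P" and h: "\<And>p. h (collide p) = h p" for h
  proof -
    have ae: "AE p in ?P. ?L (collide p) * h (collide p) = ?G p * h p"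
      using LG by eventually_elim (simp add: h)
    have "integrable ?P (\<lambda>p. ?L p * h p) \<longleftrightarrow> integrable (distr ?P ?P collide) (\<lambda>p. ?L p * h p)"
      by (simp add: distr_collide)
    also have "\<dots> \<longleftrightarrow> integrable ?P (\<lambda>p. ?L (collide p) * h (collide p))"
      by (rule integrable_distr_eq) measurable
    also have "\<dots> \<longleftrightarrow> integrable ?P (\<lambda>p. ?G p * h p)"
      using ae by (intro integrable_cong_AE) auto
    finally show "integrable ?P (\<lambda>p. ?G p * h p) \<longleftrightarrow> integrable ?P (\<lambda>p. ?L p * h p)" ..
    have "integral\<^sup>L ?P (\<lambda>p. ?L p * h p) = integral\<^sup>L (distr ?P ?P collide) (\<lambda>p. ?L p * h p)"
      by (simp add: distr_collide)
    also have "\<dots> = integral\<^sup>L ?P (\<lambda>p. ?L (collide p) * h (collide p))"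
      by (rule integral_distr) measurable
    also have "\<dots> = integral\<^sup>L ?P (\<lambda>p. ?G p * h p)"
      using ae by (intro integral_cong_AE) auto
    finally show "integral\<^sup>L ?P (\<lambda>p. ?G p * h p) = integral\<^sup>L ?P (\<lambda>p. ?L p * h p)" ..
  qed
  have gain: "integrable ?P ?G"
    using G_int[of "\<lambda>_. 1"] loss by simp
  have Qp: "integrable (xvt_measure T) (Q_plus B f u)"
    using collision_space.integrable_fst'[OF gain] by (simp add: Q_plus_def[abs_def])
  have Qm: "integrable (xvt_measure T) (Q_minus B f u)"
    using collision_space.integrable_fst'[OF loss] by (simp add: Q_minus_def[abs_def])
  show "integrable (xvt_measure T) (Q B f u)"
    unfolding Q_def[abs_def] by (intro Bochner_Integration.integrable_diff Qp Qm)
  let ?s = "\<lambda>p :: 'a point. \<tau> (snd (snd p))"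
  have s_meas [measurable]: "?s \<in> borel_measurable (xvt_measure T)"
    unfolding xvt_measure_def by measurable
  note mult = integrable_mult_bounded[where C = C]
  have "(LINT p|xvt_measure T. Q_plus B f u p * ?s p) = integral\<^sup>L ?P (\<lambda>p. ?G p * ?t p)"
    using collision_space.integral_fst'[OF mult[OF gain t_meas]] \<tau>(2)
    by (simp add: Q_plus_def)
  also have "\<dots> = integral\<^sup>L ?P (\<lambda>p. ?L p * ?t p)"
    by (rule G_eq[OF t_meas t_collide])
  also have "\<dots> = (LINT p|xvt_measure T. Q_minus B f u p * ?s p)"
    using collision_space.integral_fst'[OF mult[OF loss t_meas]] \<tau>(2)
    by (simp add: Q_minus_def)
  finally have "(LINT p|xvt_measure T. Q B f u p * ?s p) = 0"
    using mult[OF Qp s_meas] mult[OF Qm s_meas] \<tau>(2) by (simp add: Q_def left_diff_distrib)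
  then show "(LINT (x, v, t)|xvt_measure T. Q B f u (x, v, t) * \<tau> t) = 0"
    by (simp add: case_prod_unfold)
qed

section \<open>Continuous curves in L1\<close>

text \<open>Fubini for a measure that is a product only after the rearrangement \<pi> of
  coordinates. The triples (x, v, t) have to be grouped in two ways, neither of which is the nesting
  of \<open>xvt_measure\<close>.\<close>

lemma (in pair_sigma_finite) integral_disintegrate:
  fixes F :: "_ \<Rightarrow> real"
  assumes \<pi>: "\<pi> \<in> M1 \<Otimes>\<^sub>M M2 \<rightarrow>\<^sub>M M" and M: "distr (M1 \<Otimes>\<^sub>M M2) M \<pi> = M" and F: "integrable M F"
  shows "(LINT x|M1. LINT y|M2. F (\<pi> (x, y))) = integral\<^sup>L M F"
proof -
  have int: "integrable (M1 \<Otimes>\<^sub>M M2) (\<lambda>p. F (\<pi> p))"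
    using F integrable_distr_eq[OF \<pi>, of F] by (simp add: M)
  show ?thesis
    using integral_fst'[OF int] integral_distr[OF \<pi>, of F] F by (simp add: M)
qed

interpretation xv: pair_sigma_finite torus_measure lborel ..

interpretation xv_space: sigma_finite_measure xv_measure
  unfolding xv_measure_def ..

interpretation xt: pair_sigma_finite torus_measure "time_measure T" for T ..

interpretation xt_space: sigma_finite_measure "xt_measure T" for T
  unfolding xt_measure_def ..

interpretation xt_v: pair_sigma_finite "xt_measure T" lborel for T ..

interpretation t_xv: pair_sigma_finite "time_measure T" xv_measure for T ..

section \<open>Regrouping the coordinates x, v, t\<close>

lemma nn_integral_xvt:
  assumes F: "F \<in> borel_measurable (xvt_measure T)"
  shows "integral\<^sup>N (xvt_measure T) F =
    (\<integral>\<^sup>+x. \<integral>\<^sup>+t. \<integral>\<^sup>+v. F (x, v, t) \<partial>lborel \<partial>time_measure T \<partial>torus_measure)"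
proof -
  note [measurable] = F[unfolded xvt_measure_def]
  have "integral\<^sup>N (xvt_measure T) F = (\<integral>\<^sup>+x. \<integral>\<^sup>+y. F (x, y) \<partial>(lborel \<Otimes>\<^sub>M time_measure T) \<partial>torus_measure)"
    unfolding xvt_measure_def by (rule vt.nn_integral_fst[symmetric]) simp
  also have "\<dots> = (\<integral>\<^sup>+x. \<integral>\<^sup>+t. \<integral>\<^sup>+v. F (x, v, t) \<partial>lborel \<partial>time_measure T \<partial>torus_measure)"
    by (intro nn_integral_cong vt.nn_integral_snd[symmetric]) simp
  finally show ?thesis .
qed

text \<open>This grouping isolates v, because the dissipative inequality is stated for velocity
  integrals as functions of (x, t).\<close>

lemma
  shows measurable_xt_v: "(\<lambda>((x, t), v). (x, v, t)) \<in> xt_measure T \<Otimes>\<^sub>M lborel \<rightarrow>\<^sub>M xvt_measure T"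
    and distr_xt_v: "distr (xt_measure T \<Otimes>\<^sub>M lborel) (xvt_measure T) (\<lambda>((x, t), v). (x, v, t)) = xvt_measure T"
proof -
  let ?\<pi> = "\<lambda>((x, t), v). (x, v, t)"
  show \<pi>: "?\<pi> \<in> xt_measure T \<Otimes>\<^sub>M lborel \<rightarrow>\<^sub>M xvt_measure T"
    unfolding xt_measure_def xvt_measure_def case_prod_unfold by measurable
  show "distr (xt_measure T \<Otimes>\<^sub>M lborel) (xvt_measure T) ?\<pi> = xvt_measure T"
  proof (rule measure_eqI)
    fix A assume "A \<in> sets (distr (xt_measure T \<Otimes>\<^sub>M lborel) (xvt_measure T) ?\<pi>)"
    then have F: "indicator A \<in> borel_measurable (xvt_measure T)" and A: "A \<in> sets (xvt_measure T)"
      by simp_all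
    note G [measurable] = measurable_compose[OF \<pi> F]
    have "emeasure (distr (xt_measure T \<Otimes>\<^sub>M lborel) (xvt_measure T) ?\<pi>) A =
        integral\<^sup>N (distr (xt_measure T \<Otimes>\<^sub>M lborel) (xvt_measure T) ?\<pi>) (indicator A)"
      using A by (subst nn_integral_indicator) simp_all
    also have "\<dots> = (\<integral>\<^sup>+p. indicator A (?\<pi> p) \<partial>(xt_measure T \<Otimes>\<^sub>M lborel))"
      by (rule nn_integral_distr[OF \<pi>]) (use A in simp)
    also have "\<dots> = (\<integral>\<^sup>+y. \<integral>\<^sup>+v. indicator A (?\<pi> (y, v)) \<partial>lborel \<partial>xt_measure T)"
      by (rule lborel.nn_integral_fst[symmetric]) (rule G)
    also have "\<dots> = (\<integral>\<^sup>+x. \<integral>\<^sup>+t. \<integral>\<^sup>+v. indicator A (x, v, t) \<partial>lborel \<partial>time_measure T \<partial>torus_measure)"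
      using lborel.borel_measurable_nn_integral_fst[OF G] unfolding xt_measure_def
      by (subst time.nn_integral_fst[symmetric]) simp_all
    also have "\<dots> = emeasure (xvt_measure T) A"
      using nn_integral_xvt[OF F] A by simp
    finally show "emeasure (distr (xt_measure T \<Otimes>\<^sub>M lborel) (xvt_measure T) ?\<pi>) A = emeasure (xvt_measure T) A" .
  qed simp
qed

text \<open>This grouping isolates t, because the comparison is made through an integral over phase
  space at fixed time.\<close>

lemma
  shows measurable_t_xv: "(\<lambda>(t, x, v). (x, v, t)) \<in> time_measure T \<Otimes>\<^sub>M xv_measure \<rightarrow>\<^sub>M xvt_measure T"
    and distr_t_xv: "distr (time_measure T \<Otimes>\<^sub>M xv_measure) (xvt_measure T) (\<lambda>(t, x, v). (x, v, t)) = xvt_measure T"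
proof -
  let ?\<pi> = "\<lambda>(t, x, v). (x, v, t)"
  show \<pi>: "?\<pi> \<in> time_measure T \<Otimes>\<^sub>M xv_measure \<rightarrow>\<^sub>M xvt_measure T"
    unfolding xv_measure_def xvt_measure_def case_prod_unfold by measurable
  show "distr (time_measure T \<Otimes>\<^sub>M xv_measure) (xvt_measure T) ?\<pi> = xvt_measure T"
  proof (rule measure_eqI)
    fix A assume "A \<in> sets (distr (time_measure T \<Otimes>\<^sub>M xv_measure) (xvt_measure T) ?\<pi>)"
    then have F: "indicator A \<in> borel_measurable (xvt_measure T)" and A: "A \<in> sets (xvt_measure T)"
      by simp_all
    note G = measurable_compose[OF \<pi> F]
    note [measurable] = F[unfolded xvt_measure_def] G[unfolded xv_measure_def]
    have "emeasure (distr (time_measure T \<Otimes>\<^sub>M xv_measure) (xvt_measure T) ?\<pi>) A =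
        integral\<^sup>N (distr (time_measure T \<Otimes>\<^sub>M xv_measure) (xvt_measure T) ?\<pi>) (indicator A)"
      using A by (subst nn_integral_indicator) simp_all
    also have "\<dots> = (\<integral>\<^sup>+p. indicator A (?\<pi> p) \<partial>(time_measure T \<Otimes>\<^sub>M xv_measure))"
      by (rule nn_integral_distr[OF \<pi>]) (use A in simp)
    also have "\<dots> = (\<integral>\<^sup>+t. \<integral>\<^sup>+y. indicator A (?\<pi> (t, y)) \<partial>xv_measure \<partial>time_measure T)"
      by (rule xv_space.nn_integral_fst[symmetric]) (rule G)
    also have "\<dots> = (\<integral>\<^sup>+t. \<integral>\<^sup>+x. \<integral>\<^sup>+v. indicator A (x, v, t) \<partial>lborel \<partial>torus_measure \<partial>time_measure T)"
      unfolding xv_measure_def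
      by (intro nn_integral_cong, subst lborel.nn_integral_fst[symmetric]) auto
    also have "\<dots> = (\<integral>\<^sup>+x. \<integral>\<^sup>+t. \<integral>\<^sup>+v. indicator A (x, v, t) \<partial>lborel \<partial>time_measure T \<partial>torus_measure)"
      by (rule xt.Fubini') simp
    also have "\<dots> = emeasure (xvt_measure T) A"
      using nn_integral_xvt[OF F] A by simp
    finally show "emeasure (distr (time_measure T \<Otimes>\<^sub>M xv_measure) (xvt_measure T) ?\<pi>) A = emeasure (xvt_measure T) A" .
  qed simp
qed

section \<open>Stability, integrals and joint integrability of continuous curves\<close>

lemma continuous_L1_iff:
  "continuous_L1 T f \<longleftrightarrow>
     (\<forall>x v. \<forall>t\<in>{0..T}. \<forall>k\<in>integer_vectors. f (x + k, v, t) = f (x, v, t)) \<and>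
     f \<in> borel_measurable (xvt_measure T) \<and>
     (\<forall>t\<in>{0..T}. integrable xv_measure (\<lambda>y. f (fst y, snd y, t))) \<and>
     (\<forall>t\<in>{0..T}.
        ((\<lambda>s. LINT y|xv_measure. \<bar>f (fst y, snd y, s) - f (fst y, snd y, t)\<bar>) \<longlongrightarrow> 0)
          (at t within {0..T}))"
  by (simp add: continuous_L1_def case_prod_unfold)

text \<open>The Lipschitz bound dominates L1 differences of \<open>h (f p) (g p)\<close> by those of
  f and g, and with h(0,0) = 0 it also gives integrability at each time. It covers both |f| and the
  function W of the main argument.\<close>

lemma continuous_L1_lipschitz:
  assumes f: "continuous_L1 T f" and g: "continuous_L1 T g"
    and lip: "\<And>a b a' b'. \<bar>h a b - h a' b'\<bar> \<le> C * (\<bar>a - a'\<bar> + \<bar>b - b'\<bar>)"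
    and h0: "h 0 0 = (0 :: real)"
    and h [measurable]: "case_prod h \<in> borel_measurable (borel \<Otimes>\<^sub>M borel)"
  shows "continuous_L1 T (\<lambda>p. h (f p) (g p))"
proof -
  let ?f = "\<lambda>t y. f (fst y, snd y, t)" and ?g = "\<lambda>t y. g (fst y, snd y, t)"
  have fi: "integrable xv_measure (?f t)" and gi: "integrable xv_measure (?g t)" if "t \<in> {0..T}" for t
    using f g that by (auto simp: continuous_L1_iff)
  have fgi: "integrable xv_measure (\<lambda>y. C * (\<bar>?f s y - ?f t y\<bar> + \<bar>?g s y - ?g t y\<bar>))"
    if "s \<in> {0..T}" "t \<in> {0..T}" for s t
    using fi gi that by (intro integrable_mult_right Bochner_Integration.integrable_add integrable_abs
        Bochner_Integration.integrable_diff)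
  have hi: "integrable xv_measure (\<lambda>y. h (?f t y) (?g t y))" if "t \<in> {0..T}" for t
  proof (rule Bochner_Integration.integrable_bound)
    show "integrable xv_measure (\<lambda>y. C * (\<bar>?f t y\<bar> + \<bar>?g t y\<bar>))"
      using fi gi that by (intro integrable_mult_right Bochner_Integration.integrable_add integrable_abs)
    note [measurable] = borel_measurable_integrable[OF fi[OF that]] borel_measurable_integrable[OF gi[OF that]]
    show "(\<lambda>y. h (?f t y) (?g t y)) \<in> borel_measurable xv_measure"
      by measurable
    show "AE y in xv_measure. norm (h (?f t y) (?g t y)) \<le> norm (C * (\<bar>?f t y\<bar> + \<bar>?g t y\<bar>))"
      using lip[of _ _ 0 0] by (intro AE_I2) (force simp: h0 intro: order.trans[OF _ abs_ge_self])
  qed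
  have "((\<lambda>s. LINT y|xv_measure. \<bar>h (?f s y) (?g s y) - h (?f t y) (?g t y)\<bar>) \<longlongrightarrow> 0)
      (at t within {0..T})" if t: "t \<in> {0..T}" for t
  proof (rule Lim_null_comparison)
    let ?I = "\<lambda>F s. LINT y|xv_measure. \<bar>F s y - F t y\<bar>"
    have "((\<lambda>s. C * (?I ?f s + ?I ?g s)) \<longlongrightarrow> C * (0 + 0)) (at t within {0..T})"
      using f g t by (intro tendsto_intros) (auto simp: continuous_L1_iff)
    then show "((\<lambda>s. C * (?I ?f s + ?I ?g s)) \<longlongrightarrow> 0) (at t within {0..T})" by simp
    show "\<forall>\<^sub>F s in at t within {0..T}.
        norm (LINT y|xv_measure. \<bar>h (?f s y) (?g s y) - h (?f t y) (?g t y)\<bar>) \<le> C * (?I ?f s + ?I ?g s)"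
      unfolding eventually_at_filter
    proof (intro always_eventually allI impI)
      fix s assume s: "s \<in> {0..T}"
      have "(LINT y|xv_measure. \<bar>h (?f s y) (?g s y) - h (?f t y) (?g t y)\<bar>) \<le>
          (LINT y|xv_measure. C * (\<bar>?f s y - ?f t y\<bar> + \<bar>?g s y - ?g t y\<bar>))"
        using hi s t by (intro integral_mono fgi lip integrable_abs Bochner_Integration.integrable_diff)
      also have "\<dots> = C * (?I ?f s + ?I ?g s)"
        using fi[OF s] fi[OF t] gi[OF s] gi[OF t]
        by (simp add: Bochner_Integration.integral_add[OF integrable_abs integrable_abs])
      finally show "norm (LINT y|xv_measure. \<bar>h (?f s y) (?g s y) - h (?f t y) (?g t y)\<bar>) \<le> C * (?I ?f s + ?I ?g s)"
        by (simp add: integral_nonneg_AE)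
    qed
  qed
  moreover have "(\<lambda>p. h (f p) (g p)) \<in> borel_measurable (xvt_measure T)"
    using f g by (auto simp: continuous_L1_iff)
  ultimately show ?thesis
    using f g hi by (auto simp: continuous_L1_iff)
qed

lemma continuous_L1_abs: "continuous_L1 T f \<Longrightarrow> continuous_L1 T (\<lambda>p. \<bar>f p\<bar>)"
  using continuous_L1_lipschitz[of T f f "\<lambda>a b. \<bar>a\<bar>" 1] by simp

lemma continuous_on_integral_continuous_L1:
  assumes f: "continuous_L1 T f"
  shows "continuous_on {0..T} (\<lambda>t. LINT (x, v)|xv_measure. f (x, v, t))"
  unfolding continuous_on_def
proof
  fix t assume t: "t \<in> {0..T}"
  let ?f = "\<lambda>t y. f (fst y, snd y, t)"
  have fi: "integrable xv_measure (?f t)" if "t \<in> {0..T}" for t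
    using f that by (auto simp: continuous_L1_iff)
  have "((\<lambda>s. integral\<^sup>L xv_measure (?f s) - integral\<^sup>L xv_measure (?f t)) \<longlongrightarrow> 0) (at t within {0..T})"
  proof (rule Lim_null_comparison)
    show "((\<lambda>s. LINT y|xv_measure. \<bar>?f s y - ?f t y\<bar>) \<longlongrightarrow> 0) (at t within {0..T})"
      using f t by (auto simp: continuous_L1_iff)
    show "\<forall>\<^sub>F s in at t within {0..T}. norm (integral\<^sup>L xv_measure (?f s) - integral\<^sup>L xv_measure (?f t))
        \<le> (LINT y|xv_measure. \<bar>?f s y - ?f t y\<bar>)"
      unfolding eventually_at_filter
    proof (intro always_eventually allI impI)
      fix s assume s: "s \<in> {0..T}"
      show "norm (integral\<^sup>L xv_measure (?f s) - integral\<^sup>L xv_measure (?f t))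
        \<le> (LINT y|xv_measure. \<bar>?f s y - ?f t y\<bar>)"
        using integral_abs_bound[of xv_measure "\<lambda>y. ?f s y - ?f t y"] fi[OF s] fi[OF t] by simp
    qed
  qed
  then show "((\<lambda>t. LINT (x, v)|xv_measure. f (x, v, t)) \<longlongrightarrow> (LINT (x, v)|xv_measure. f (x, v, t))) (at t within {0..T})"
    by (simp add: LIM_zero_iff case_prod_unfold)
qed

text \<open>The L1 norm at time t is continuous on the compact interval [0,T], hence bounded, and
  the interval has finite length.\<close>

lemma integrable_continuous_L1:
  assumes f: "continuous_L1 T f"
  shows "integrable (xvt_measure T) f"
proof (rule integrableI_bounded)
  show m: "f \<in> borel_measurable (xvt_measure T)" using f by (simp add: continuous_L1_iff)
  have "continuous_on {0..T} (\<lambda>t. LINT (x, v)|xv_measure. \<bar>f (x, v, t)\<bar>)"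
    using continuous_on_integral_continuous_L1[OF continuous_L1_abs[OF f]] .
  then have "bounded ((\<lambda>t. LINT (x, v)|xv_measure. \<bar>f (x, v, t)\<bar>) ` {0..T})"
    by (intro compact_imp_bounded compact_continuous_image compact_Icc)
  then obtain K where K: "\<And>t. t \<in> {0..T} \<Longrightarrow> \<bar>LINT (x, v)|xv_measure. \<bar>f (x, v, t)\<bar>\<bar> \<le> K"
    unfolding bounded_iff by fastforce
  let ?\<pi> = "\<lambda>(t, x, v). (x, v, t)"
  have mm: "(\<lambda>p. ennreal (norm (f p))) \<in> borel_measurable (xvt_measure T)" using m by measurable
  have "(\<integral>\<^sup>+p. ennreal (norm (f p)) \<partial>xvt_measure T) =
      (\<integral>\<^sup>+p. ennreal (norm (f p)) \<partial>distr (time_measure T \<Otimes>\<^sub>M xv_measure) (xvt_measure T) ?\<pi>)"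
    by (simp add: distr_t_xv)
  also have "\<dots> = (\<integral>\<^sup>+p. ennreal (norm (f (?\<pi> p))) \<partial>(time_measure T \<Otimes>\<^sub>M xv_measure))"
    by (rule nn_integral_distr[OF measurable_t_xv]) (use m in measurable)
  also have "\<dots> = (\<integral>\<^sup>+t. \<integral>\<^sup>+y. ennreal (norm (f (?\<pi> (t, y)))) \<partial>xv_measure \<partial>time_measure T)"
    by (rule xv_space.nn_integral_fst[symmetric]) (rule measurable_compose[OF measurable_t_xv mm])
  also have "\<dots> \<le> (\<integral>\<^sup>+t. ennreal K \<partial>time_measure T)"
  proof (rule nn_integral_mono)
    fix t assume "t \<in> space (time_measure T)"
    then have t: "t \<in> {0..T}" by (simp add: time_measure_def space_restrict_space)
    then have "integrable xv_measure (\<lambda>(x, v). f (x, v, t))" using f by (simp add: continuous_L1_def)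
    then have "integrable xv_measure (\<lambda>y. norm (f (?\<pi> (t, y))))"
      using integrable_norm by (simp add: case_prod_unfold)
    then show "(\<integral>\<^sup>+y. ennreal (norm (f (?\<pi> (t, y)))) \<partial>xv_measure) \<le> ennreal K"
      using K[OF t] by (subst nn_integral_eq_integral) (auto simp: case_prod_unfold intro!: ennreal_leI)
  qed
  also have "\<dots> < \<infinity>"
    by (simp add: time_measure_def space_restrict_space emeasure_restrict_space ennreal_mult_less_top emeasure_lborel_Icc_eq)
  finally show "(\<integral>\<^sup>+p. ennreal (norm (f p)) \<partial>xvt_measure T) < \<infinity>" .
qed

text \<open>For nonnegative B, the modulus of the loss integrand of f and g is the loss integrand of
  |f| and |g|. Regularity of g, applied to |f|, supplies both hypotheses of Fubini's criterion:
  almost everywhere convergence of the inner integrals and integrability of their values. The second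
  alone would not do, since divergent integrals count as 0.\<close>

lemma integrable_loss_integrand:
  assumes B: "collision_kernel B" and f: "continuous_L1 T f" "bounded_energy T f"
    and g: "sufficiently_regular B T g"
  shows "integrable (xvt_measure T \<Otimes>\<^sub>M ws_measure) (case_prod (loss_integrand B f g))"
proof (rule collision_space.Fubini_integrable)
  let ?f = "\<lambda>p. \<bar>f p\<bar>" and ?g = "\<lambda>p. \<bar>g p\<bar>"
  have fm: "f \<in> borel_measurable (xvt_measure T)" and gm: "g \<in> borel_measurable (xvt_measure T)"
    using f g by (auto simp: sufficiently_regular_def continuous_L1_def)
  show meas: "case_prod (loss_integrand B f g) \<in> borel_measurable (xvt_measure T \<Otimes>\<^sub>M ws_measure)"
    by (rule measurable_loss_integrand[OF B fm gm])
  have "bounded_energy T ?f"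
    unfolding bounded_energy_def
  proof -
    from f(2) obtain C where "AE t in time_measure T.
        integrable xv_measure (\<lambda>(x, v). f (x, v, t) * (norm v)\<^sup>2) \<and>
        (LINT (x, v)|xv_measure. \<bar>f (x, v, t) * (norm v)\<^sup>2\<bar>) \<le> C"
      unfolding bounded_energy_def by auto
    then have "AE t in time_measure T.
        integrable xv_measure (\<lambda>(x, v). \<bar>f (x, v, t)\<bar> * (norm v)\<^sup>2) \<and>
        (LINT (x, v)|xv_measure. \<bar>\<bar>f (x, v, t)\<bar> * (norm v)\<^sup>2\<bar>) \<le> C"
    proof eventually_elim
      case (elim t)
      then have "integrable xv_measure (\<lambda>y. \<bar>case y of (x, v) \<Rightarrow> f (x, v, t) * (norm v)\<^sup>2\<bar>)"
        by (intro integrable_abs) simp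
      then show ?case using elim by (simp add: case_prod_unfold abs_mult)
    qed
    then show "\<exists>C. AE t in time_measure T.
        integrable xv_measure (\<lambda>(x, v). \<bar>f (x, v, t)\<bar> * (norm v)\<^sup>2) \<and>
        (LINT (x, v)|xv_measure. \<bar>\<bar>f (x, v, t)\<bar> * (norm v)\<^sup>2\<bar>) \<le> C" ..
  qed
  with g continuous_L1_abs[OF f(1)] have conv: "collision_converges B T ?f ?g"
    and int: "integrable (xvt_measure T) (Q_minus B ?f ?g)"
    by (auto simp: sufficiently_regular_def)
  have abs: "norm (loss_integrand B f g p q) = loss_integrand B ?f ?g p q"
    if "q \<in> space ws_measure" for p q
    using that B by (cases p; cases q)
      (auto simp: loss_integrand_def abs_mult collision_kernel_def space_pair_measure space_sphere_measure)
  have "(LINT q|ws_measure. norm (case (p, q) of (p, q) \<Rightarrow> loss_integrand B f g p q)) = Q_minus B ?f ?g p" for p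
    unfolding Q_minus_def by (rule Bochner_Integration.integral_cong) (simp_all add: abs del: real_norm_def)
  then show "integrable (xvt_measure T)
      (\<lambda>p. LINT q|ws_measure. norm (case (p, q) of (p, q) \<Rightarrow> loss_integrand B f g p q))"
    using int by simp
  show "AE p in xvt_measure T. integrable ws_measure (\<lambda>q. case (p, q) of (p, q) \<Rightarrow> loss_integrand B f g p q)"
    using conv[unfolded collision_converges_def] AE_space
  proof eventually_elim
    case (elim p)
    have "(\<lambda>q. case_prod (loss_integrand B f g) (p, q)) \<in> borel_measurable ws_measure"
      using measurable_compose[OF measurable_Pair1'[OF elim(2)] meas] by simp
    moreover have "integrable ws_measure (loss_integrand B ?f ?g p)" using elim by simp
    moreover have "norm (case_prod (loss_integrand B f g) (p, q)) \<le> norm (loss_integrand B ?f ?g p q)"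
      if "q \<in> space ws_measure" for q
      using abs[OF that, of p] by simp
    ultimately show ?case
      by (rule_tac Bochner_Integration.integrable_bound[of ws_measure "loss_integrand B ?f ?g p"])
         (auto intro: AE_I2)
  qed
qed

text \<open>These facts admit 0 as a comparison function, which turns the dissipative inequality
  into the mass estimate for f.\<close>

lemma
  shows Q_zero: "Q B f (\<lambda>_. 0) p = 0"
    and has_transport_derivative_zero: "has_transport_derivative T (\<lambda>_. 0) (\<lambda>_. 0)"
    and sufficiently_regular_zero: "sufficiently_regular B T (\<lambda>_. 0)"
proof -
  have zero: "gain_integrand B f (\<lambda>_. 0) p = (\<lambda>_. 0)" "loss_integrand B f (\<lambda>_. 0) p = (\<lambda>_. 0)" for f p
    by (cases p; auto simp: gain_integrand_def loss_integrand_def)+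
  then show "Q B f (\<lambda>_. 0) p = 0"
    by (simp add: Q_def Q_plus_def Q_minus_def)
  show htd: "has_transport_derivative T (\<lambda>_. 0) (\<lambda>_. 0)"
    by (simp add: has_transport_derivative_def transport_eq_def case_prod_unfold)
  show "sufficiently_regular B T (\<lambda>_. 0)"
    unfolding sufficiently_regular_def
    using htd by (auto simp: continuous_L1_def bounded_energy_def collision_converges_def zero case_prod_unfold
        Q_plus_def[abs_def] Q_minus_def[abs_def])
qed

section \<open>Test functions of time\<close>

text \<open>The derivative is carried along as a second function, in the form in which the
  monotonicity criterion for weak derivatives supplies it.\<close>

definition time_test :: "real \<Rightarrow> (real \<Rightarrow> real) \<Rightarrow> (real \<Rightarrow> real) \<Rightarrow> bool" where
  "time_test T \<tau> \<tau>' \<longleftrightarrow> smooth \<tau> \<and> (\<forall>t. (\<tau> has_real_derivative \<tau>' t) (at t)) \<and>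
     continuous_on UNIV \<tau>' \<and> (\<exists>K. compact K \<and> K \<subseteq> {0<..<T} \<and> (\<forall>t. t \<notin> K \<longrightarrow> \<tau> t = 0))"

lemma time_test_bounded:
  assumes "time_test T \<tau> \<tau>'"
  obtains C where "\<And>t. \<bar>\<tau> t\<bar> \<le> C" "\<And>t. \<bar>\<tau>' t\<bar> \<le> C"
proof -
  from assms obtain K where K: "compact K" "\<And>t. t \<notin> K \<Longrightarrow> \<tau> t = 0"
    and d: "\<And>t. (\<tau> has_real_derivative \<tau>' t) (at t)" and sm: "smooth \<tau>" and c: "continuous_on UNIV \<tau>'"
    unfolding time_test_def by auto
  \<comment> \<open>The complement of K is open, so \<tau> vanishes near t and not only at
    t.\<close>
  have 0: "\<tau>' t = 0" if "t \<notin> K" for t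
  proof -
    have "open (- K)" by (rule open_Compl[OF compact_imp_closed[OF K(1)]])
    then have "((\<lambda>_. 0) has_real_derivative \<tau>' t) (at t)"
      using has_field_derivative_transform_within_open[OF d, of "- K" t "\<lambda>_. 0"] that K(2) by auto
    then show ?thesis using DERIV_unique[of "\<lambda>_. 0" "\<tau>' t" t 0] by simp
  qed
  have "bounded (F ` K)" if "continuous_on UNIV F" for F :: "real \<Rightarrow> real"
    using K(1) that continuous_on_subset by (blast intro: compact_imp_bounded compact_continuous_image)
  from this[OF smooth_continuous[OF sm]] this[OF c] obtain C1 C2
    where "\<forall>t\<in>K. \<bar>\<tau> t\<bar> \<le> C1" "\<forall>t\<in>K. \<bar>\<tau>' t\<bar> \<le> C2"
    by (auto simp: bounded_iff)
  then have "\<bar>\<tau> t\<bar> \<le> max 0 (max C1 C2)" "\<bar>\<tau>' t\<bar> \<le> max 0 (max C1 C2)" for t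
    using K(2)[of t] 0[of t] by (cases "t \<in> K"; fastforce)+
  then show ?thesis using that by blast
qed

lemma time_test_borel:
  assumes "time_test T \<tau> \<tau>'"
  shows "\<tau> \<in> borel_measurable borel" "\<tau>' \<in> borel_measurable borel"
    and "(\<lambda>p. \<tau> (snd (snd p))) \<in> borel_measurable (xvt_measure S)"
    and "(\<lambda>p. \<tau>' (snd (snd p))) \<in> borel_measurable (xvt_measure S)"
proof -
  show b: "\<tau> \<in> borel_measurable borel" "\<tau>' \<in> borel_measurable borel"
    using assms smooth_continuous by (auto simp: time_test_def intro: borel_measurable_continuous_onI)
  have [measurable]: "\<tau> \<in> borel_measurable (time_measure S)" "\<tau>' \<in> borel_measurable (time_measure S)"
    using b by (simp_all add: time_measure_def measurable_restrict_space1)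
  show "(\<lambda>p. \<tau> (snd (snd p))) \<in> borel_measurable (xvt_measure S)"
    "(\<lambda>p. \<tau>' (snd (snd p))) \<in> borel_measurable (xvt_measure S)"
    unfolding xvt_measure_def by measurable
qed

lemma integrable_mult_time_test:
  assumes "time_test T \<tau> \<tau>'" "integrable (xvt_measure S) F"
  shows "integrable (xvt_measure S) (\<lambda>p. F p * \<tau> (snd (snd p)))"
    and "integrable (xvt_measure S) (\<lambda>p. F p * \<tau>' (snd (snd p)))"
proof -
  obtain C where "\<And>t. \<bar>\<tau> t\<bar> \<le> C" "\<And>t. \<bar>\<tau>' t\<bar> \<le> C"
    using time_test_bounded[OF assms(1)] by blast
  then show "integrable (xvt_measure S) (\<lambda>p. F p * \<tau> (snd (snd p)))"
    "integrable (xvt_measure S) (\<lambda>p. F p * \<tau>' (snd (snd p)))"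
    by (rule_tac integrable_mult_bounded[OF assms(2) time_test_borel(3)[OF assms(1)], where C = C]
        integrable_mult_bounded[OF assms(2) time_test_borel(4)[OF assms(1)], where C = C]; simp)+
qed

text \<open>A test function constant in x annihilates the flux, which is why \<open>j\<close> is
  arbitrary here.\<close>

lemma balance_time_test:
  fixes R S :: "'d::finite point \<Rightarrow> real"
  assumes bal: "balance_le T (\<lambda>(x, t). LINT v|lborel. R (x, v, t)) j (\<lambda>(x, t). LINT v|lborel. S (x, v, t))"
    and R: "integrable (xvt_measure T) R" and S: "integrable (xvt_measure T) S"
    and \<tau>: "time_test T \<tau> \<tau>'" "\<And>t. 0 \<le> \<tau> t"
  shows "- (LINT p|xvt_measure T. R p * \<tau>' (snd (snd p))) \<le> (LINT p|xvt_measure T. S p * \<tau> (snd (snd p)))"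
proof -
  let ?\<psi> = "\<lambda>y :: (real ^ 'd) \<times> real. \<tau> (snd y)"
  have d: "(\<tau> has_real_derivative \<tau>' t) (at t)" for t using \<tau> by (auto simp: time_test_def)
  have deriv: "frechet_derivative ?\<psi> (at y) h = snd h * \<tau>' (snd y)" for y h
  proof -
    have "(?\<psi> has_derivative (\<lambda>h. snd h * \<tau>' (snd y))) (at y)"
      using has_derivative_compose[OF has_derivative_snd[OF has_derivative_ident]
          d[of "snd y", unfolded has_field_derivative_def]]
      by (simp add: mult.commute)
    then show ?thesis using frechet_derivative_at by metis
  qed
  have "test_xt T ?\<psi>"
    using \<tau>(1) smooth_compose[OF _ smooth_linear[OF bounded_linear_snd]]
    by (auto simp: test_xt_def time_test_def)
  with bal \<tau>(2) have "- (LINT y|xt_measure T. frechet_derivative ?\<psi> (at y) (j y, case y of (x, t) \<Rightarrow> LINT v|lborel. R (x, v, t)))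
      \<le> (LINT y|xt_measure T. (case y of (x, t) \<Rightarrow> LINT v|lborel. S (x, v, t)) * ?\<psi> y)"
    unfolding balance_le_def by blast
  moreover have "(LINT y|xt_measure T. frechet_derivative ?\<psi> (at y) (j y, case y of (x, t) \<Rightarrow> LINT v|lborel. R (x, v, t))) =
      (LINT p|xvt_measure T. R p * \<tau>' (snd (snd p)))"
    using xt_v.integral_disintegrate[OF measurable_xt_v distr_xt_v integrable_mult_time_test(2)[OF \<tau>(1) R]]
    by (simp add: deriv case_prod_unfold)
  moreover have "(LINT y|xt_measure T. (case y of (x, t) \<Rightarrow> LINT v|lborel. S (x, v, t)) * ?\<psi> y) =
      (LINT p|xvt_measure T. S p * \<tau> (snd (snd p)))"
    using xt_v.integral_disintegrate[OF measurable_xt_v distr_xt_v integrable_mult_time_test(1)[OF \<tau>(1) S]]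
    by (simp add: case_prod_unfold)
  ultimately show ?thesis by simp
qed

section \<open>Cutoffs in velocity and the transport equation\<close>

lemma smooth_sum: "finite A \<Longrightarrow> (\<And>i. i \<in> A \<Longrightarrow> smooth (F i)) \<Longrightarrow> smooth (\<lambda>x. \<Sum>i\<in>A. F i x)"
  by (induction A rule: finite_induct) (auto simp: smooth_const intro: smooth_add)

lemma smooth_norm_square:
  fixes L :: "'a::euclidean_space \<Rightarrow> 'b::euclidean_space"
  assumes "bounded_linear L"
  shows "smooth (\<lambda>x. (norm (L x))\<^sup>2)"
proof -
  have "smooth (\<lambda>x. \<Sum>b\<in>Basis. (L x \<bullet> b) * (L x \<bullet> b))"
    by (intro smooth_sum smooth_mult smooth_linear bounded_linear_compose[OF bounded_linear_inner_left assms]) simp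
  then show ?thesis
    by (simp add: power2_norm_eq_inner euclidean_inner[of "L _" "L _"])
qed

text \<open>The standard bump on the ball of radius n + 1. The factor exp 1 normalises the value at
  v = 0, hence also the pointwise limit, to 1; the square of the norm keeps it smooth at 0, and
  \<open>Suc n\<close> keeps the radius positive.\<close>

definition velocity_cutoff :: "nat \<Rightarrow> 'a::real_normed_vector \<Rightarrow> real" where
  "velocity_cutoff n v = exp 1 * flat_exp 0 (1 - (norm v)\<^sup>2 / (real (Suc n))\<^sup>2)"

lemma velocity_cutoff_bounds: "0 \<le> velocity_cutoff n v" "velocity_cutoff n v \<le> 1"
proof -
  let ?s = "1 - (norm v)\<^sup>2 / (real (Suc n))\<^sup>2"
  have "exp 1 * exp (- (1 / ?s)) \<le> exp (0 :: real)" if "?s > 0"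
  proof -
    have "?s \<le> 1" by simp
    then have "1 / ?s \<ge> 1" using that by simp
    then show ?thesis unfolding mult_exp_exp by (simp del: exp_zero)
  qed
  then show "velocity_cutoff n v \<le> 1"
    by (auto simp: velocity_cutoff_def flat_exp_def)
  show "0 \<le> velocity_cutoff n v" by (simp add: velocity_cutoff_def flat_exp_def)
qed

lemma velocity_cutoff_support: "velocity_cutoff n v = 0" if "norm v \<ge> Suc n"
proof -
  have "(norm v)\<^sup>2 \<ge> (real (Suc n))\<^sup>2" using that by (intro power_mono) auto
  then have "1 \<le> (norm v)\<^sup>2 / (real (Suc n))\<^sup>2" by (subst le_divide_eq_1_pos) auto
  then have "\<not> 0 < 1 - (norm v)\<^sup>2 / (real (Suc n))\<^sup>2" by linarith
  then show ?thesis by (simp only: velocity_cutoff_def flat_exp_def if_False mult_zero_right)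
qed

lemma velocity_cutoff_tendsto: "(\<lambda>n. velocity_cutoff n v) \<longlonglongrightarrow> 1"
proof -
  have "(\<lambda>n. inverse (real (Suc n))) \<longlonglongrightarrow> 0" by (rule LIMSEQ_inverse_real_of_nat)
  then have "(\<lambda>n. 1 - (norm v)\<^sup>2 * (inverse (real (Suc n)))\<^sup>2) \<longlonglongrightarrow> 1 - (norm v)\<^sup>2 * 0\<^sup>2"
    by (intro tendsto_intros)
  then have lim: "(\<lambda>n. 1 - (norm v)\<^sup>2 / (real (Suc n))\<^sup>2) \<longlonglongrightarrow> 1"
    by (simp add: divide_inverse power_inverse)
  have "isCont (flat_exp 0) 1" using flat_exp_deriv DERIV_isCont by blast
  from isCont_tendsto_compose[OF this lim]
  have "(\<lambda>n. exp 1 * flat_exp 0 (1 - (norm v)\<^sup>2 / (real (Suc n))\<^sup>2)) \<longlonglongrightarrow> exp 1 * flat_exp 0 1"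
    by (intro tendsto_intros)
  then show ?thesis
    by (simp add: velocity_cutoff_def flat_exp_def flip: exp_add)
qed

text \<open>Multiplying \<tau> by a cutoff in v makes it admissible. The transport operator does not
  differentiate in v, so the cutoff produces no error term, and dominated convergence removes it
  from both sides.\<close>

lemma transport_time_test:
  fixes g :: "'d::finite point \<Rightarrow> real"
  assumes eq: "transport_eq T g h"
    and g: "integrable (xvt_measure T) g" and h: "integrable (xvt_measure T) h"
    and \<tau>: "time_test T \<tau> \<tau>'"
  shows "- (LINT p|xvt_measure T. g p * \<tau>' (snd (snd p))) = (LINT p|xvt_measure T. h p * \<tau> (snd (snd p)))"
proof -
  let ?\<zeta> = "\<lambda>n p :: 'd point. velocity_cutoff n (fst (snd p))"
  let ?\<phi> = "\<lambda>n p :: 'd point. ?\<zeta> n p * \<tau> (snd (snd p))"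
  have d: "(\<tau> has_real_derivative \<tau>' t) (at t)" for t using \<tau> by (auto simp: time_test_def)
  have sm: "smooth (?\<phi> n)" for n
  proof (rule smooth_mult)
    show "smooth (\<lambda>p :: 'd point. \<tau> (snd (snd p)))"
    proof (rule smooth_compose[of \<tau>])
      show "smooth \<tau>" using \<tau> by (simp add: time_test_def)
      show "smooth (\<lambda>p :: 'd point. snd (snd p))"
        by (rule smooth_linear, rule bounded_linear_compose[OF bounded_linear_snd bounded_linear_snd])
    qed
    show "smooth (?\<zeta> n)"
    proof -
      have "smooth (\<lambda>p :: 'd point. 1 - (norm (fst (snd p)))\<^sup>2 * inverse ((real (Suc n))\<^sup>2))"
        by (rule smooth_diff[OF smooth_const smooth_mult[OF smooth_norm_square smooth_const]])
           (rule bounded_linear_compose[OF bounded_linear_fst bounded_linear_snd])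
      from smooth_mult[OF smooth_const smooth_compose[OF smooth_flat_exp this], of "exp 1" 0] show ?thesis
        by (simp only: velocity_cutoff_def divide_inverse)
    qed
  qed
  have deriv: "frechet_derivative (?\<phi> n) (at (x, v, t)) (v, 0, 1) = ?\<zeta> n (x, v, t) * \<tau>' t" for n x v t
  proof -
    let ?D = "frechet_derivative (?\<phi> n) (at (x, v, t))"
    \<comment> \<open>The direction (v, 0, 1) leaves the velocity component unchanged, so along this
      line the cutoff is a constant factor and only \<tau> is differentiated.\<close>
    let ?line = "\<lambda>s :: real. (x, v, t) + s *\<^sub>R (v, 0, 1)"
    have "C_k (Suc 0) (?\<phi> n)" using sm by (simp only: smooth_def)
    from C_k_SucD(1)[OF this, of "?line 0"] have "(?\<phi> n has_derivative ?D) (at (?line 0))" by simp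
    moreover have "(?line has_derivative (\<lambda>s. 0 + s *\<^sub>R (v, 0, 1))) (at 0)"
      by (intro has_derivative_add has_derivative_const has_derivative_scaleR_left has_derivative_ident)
    ultimately have "((\<lambda>s. ?\<phi> n (?line s)) has_derivative (\<lambda>s. ?D (0 + s *\<^sub>R (v, 0, 1)))) (at 0)"
      by (rule has_derivative_compose[rotated])
    moreover have "((\<lambda>s. ?\<phi> n (?line s)) has_real_derivative ?\<zeta> n (x, v, t) * \<tau>' t) (at 0)"
      using DERIV_cmult[OF DERIV_chain2[OF d[of "t + 0"] DERIV_add[OF DERIV_const DERIV_ident]], of "?\<zeta> n (x, v, t)"]
      by simp
    ultimately have "(\<lambda>s. ?D (0 + s *\<^sub>R (v, 0, 1))) = (*) (?\<zeta> n (x, v, t) * \<tau>' t)"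
      unfolding has_field_derivative_def by (rule has_derivative_unique)
    then have "?D (0 + 1 *\<^sub>R (v, 0, 1)) = ?\<zeta> n (x, v, t) * \<tau>' t * 1" by (rule fun_cong)
    then show ?thesis by simp
  qed
  have test: "test_xvt T (?\<phi> n)" for n
  proof -
    from \<tau> obtain K where K: "compact K" "K \<subseteq> {0<..<T}" "\<And>t. t \<notin> K \<Longrightarrow> \<tau> t = 0"
      unfolding time_test_def by auto
    then have "\<exists>K. compact K \<and> K \<subseteq> UNIV \<times> {0<..<T} \<and> (\<forall>x v t. (v, t) \<notin> K \<longrightarrow> ?\<phi> n (x, v, t) = 0)"
      by (intro exI[of _ "cball (0 :: real ^ 'd) (Suc n) \<times> K"])
         (auto intro!: compact_Times compact_cball velocity_cutoff_support)
    then show ?thesis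
      unfolding test_xvt_def using sm[of n] by simp
  qed
  have approx: "- (LINT p|xvt_measure T. g p * \<tau>' (snd (snd p)) * ?\<zeta> n p) =
      (LINT p|xvt_measure T. h p * \<tau> (snd (snd p)) * ?\<zeta> n p)" for n
  proof -
    have "- (LINT (x, v, t)|xvt_measure T. g (x, v, t) * frechet_derivative (?\<phi> n) (at (x, v, t)) (v, 0, 1)) =
        (LINT p|xvt_measure T. h p * ?\<phi> n p)"
      using eq test[of n] unfolding transport_eq_def by blast
    then show ?thesis
      unfolding deriv by (simp add: case_prod_unfold mult_ac)
  qed
  have lim: "(\<lambda>n. LINT p|xvt_measure T. F p * ?\<zeta> n p) \<longlonglongrightarrow> (LINT p|xvt_measure T. F p)"
    if F: "integrable (xvt_measure T) F" for F
  proof (rule integral_dominated_convergence)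
    have [measurable]: "velocity_cutoff n \<in> borel_measurable (borel :: (real ^ 'd) measure)" for n
      unfolding velocity_cutoff_def[abs_def]
      using borel_measurable_continuous_onI[OF smooth_continuous[OF smooth_flat_exp[of 0]]] by measurable
    have "?\<zeta> n \<in> borel_measurable (xvt_measure T)" for n
      unfolding xvt_measure_def by measurable
    then show "(\<lambda>p. F p * ?\<zeta> n p) \<in> borel_measurable (xvt_measure T)" for n
      using F by simp
    show "F \<in> borel_measurable (xvt_measure T)" using F by simp
    show "integrable (xvt_measure T) (\<lambda>p. \<bar>F p\<bar>)" using F by simp
    show "AE p in xvt_measure T. (\<lambda>n. F p * ?\<zeta> n p) \<longlonglongrightarrow> F p"
      using tendsto_mult[OF tendsto_const velocity_cutoff_tendsto] by fastforce
    show "AE p in xvt_measure T. norm (F p * ?\<zeta> n p) \<le> \<bar>F p\<bar>" for n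
      by (intro AE_I2) (simp add: abs_mult velocity_cutoff_bounds mult_left_le)
  qed
  from tendsto_minus[OF lim[OF integrable_mult_time_test(2)[OF \<tau> g]]] lim[OF integrable_mult_time_test(1)[OF \<tau> h]]
  show ?thesis
    unfolding approx by (rule LIMSEQ_unique)
qed

section \<open>The comparison principle\<close>

lemma dissipative_solution_balance:
  assumes "dissipative_solution B T f" "sufficiently_regular B T g" "has_transport_derivative T g Dg"
    and "\<theta> \<in> {-1..1}"
  shows "balance_le T (\<lambda>(x, t). LINT v|lborel. \<bar>f (x, v, t) - g (x, v, t)\<bar>)
    (\<lambda>(x, t). LINT v|lborel. \<bar>f (x, v, t) - g (x, v, t)\<bar> *\<^sub>R v)
    (\<lambda>(x, t). LINT v|lborel. (Q B f g (x, v, t) - Dg (x, v, t)) * sign_with \<theta> (f (x, v, t) - g (x, v, t)))"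
  using assms(1)[unfolded dissipative_solution_def, THEN conjunct2, THEN conjunct2] assms(2-4)
  by (elim allE ballE impE) auto

theorem theorem11:
  fixes B :: "real ^ 'd \<Rightarrow> real ^ 'd \<Rightarrow> real"
    and T :: real
    and f g Dg :: "(real ^ 'd) \<times> (real ^ 'd) \<times> real \<Rightarrow> real"
    and U :: "((real ^ 'd) \<times> (real ^ 'd) \<times> real) set"
  assumes "CARD('d) \<ge> 2"
    and "collision_kernel B"
    and "T > 0"
    and "dissipative_solution B T f"
    and "sufficiently_regular B T g"
    and "has_transport_derivative T g Dg"
    and "U \<in> sets (completion (xvt_measure T))"
    and "AE (x, v) in xv_measure. f (x, v, 0) \<le> g (x, v, 0)"
    and "AE p in xvt_measure T. p \<in> U \<longrightarrow> Dg p - Q B f g p \<ge> 0"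
    and "AE p in xvt_measure T. p \<notin> U \<longrightarrow> f p \<le> g p"
  shows "\<forall>t\<in>{0..T}. AE (x, v) in xv_measure. f (x, v, t) \<le> g (x, v, t)"
proof -
  let ?M = "xvt_measure T :: 'd point measure"
  let ?q = "Q B f g" and ?s = "\<lambda>p. sign_with (- 1) (f p - g p)"
  have fC: "continuous_L1 T f" and fE: "bounded_energy T f" and f0: "AE p in ?M. 0 \<le> f p"
    using assms(4) by (auto simp: dissipative_solution_def renormalized_solution_def)
  have gC: "continuous_L1 T g" using assms(5) by (simp add: sufficiently_regular_def)
  have fi: "integrable ?M f" and gi: "integrable ?M g"
    using integrable_continuous_L1 fC gC by blast+
  have Di: "integrable ?M Dg" and Deq: "transport_eq T g Dg"
    using assms(6) by (auto simp: has_transport_derivative_def)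
  note loss = integrable_loss_integrand[OF assms(2) fC fE assms(5)]
  note [measurable] = borel_measurable_integrable[OF fi] borel_measurable_integrable[OF gi]
  have qi: "integrable ?M ?q"
    by (rule integral_Q_eq_0(1)[OF assms(2) _ _ loss, of "\<lambda>_. 0" 0]) simp_all
  have di: "integrable ?M (\<lambda>p. \<bar>f p - g p\<bar>)" using fi gi by simp
  have s_meas [measurable]: "?s \<in> borel_measurable ?M"
    unfolding sign_with_def by measurable
  have Si: "integrable ?M (\<lambda>p. (?q p - Dg p) * ?s p)"
    using qi Di by (intro integrable_mult_bounded[where C = 1] Bochner_Integration.integrable_diff s_meas)
      (auto simp: sign_with_def sgn_real_def)

  define W where "W p = \<bar>f p - g p\<bar> + f p - g p" for p
  have W_eq: "W = (\<lambda>p. (\<lambda>a b. \<bar>a - b\<bar> + a - b) (f p) (g p))" by (simp add: W_def fun_eq_iff)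
  have WC: "continuous_L1 T W"
    unfolding W_eq
  proof (rule continuous_L1_lipschitz[OF fC gC])
    \<comment> \<open>Each of |a - b| and a - b contributes a Lipschitz constant 1, which gives
      2.\<close>
    show "\<bar>\<bar>a - b\<bar> + a - b - (\<bar>a' - b'\<bar> + a' - b')\<bar> \<le> 2 * (\<bar>a - a'\<bar> + \<bar>b - b'\<bar>)"
      for a b a' b' :: real
      using abs_triangle_ineq3[of "a - b" "a' - b'"] abs_triangle_ineq4[of "a - a'" "b - b'"]
      by (simp add: abs_le_iff) argo
  qed simp_all
  note Wi = integrable_continuous_L1[OF WC]
  have W_nonneg: "W p \<ge> 0" for p by (simp add: W_def)
  have W_zero: "W p = 0 \<longleftrightarrow> f p \<le> g p" for p by (auto simp: W_def)
  define M where "M t = (LINT (x, v)|xv_measure. W (x, v, t))" for t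
  have M_cont: "continuous_on {0..T} M"
    unfolding M_def by (rule continuous_on_integral_continuous_L1[OF WC])
  have weak: "0 \<le> (LINT t|time_measure T. M t * \<tau>' t)"
    if \<tau>: "time_test T \<tau> \<tau>'" and \<tau>0: "\<And>t. 0 \<le> \<tau> t" for \<tau> \<tau>'
  proof -
    let ?t = "\<lambda>p :: 'd point. \<tau> (snd (snd p))" and ?t' = "\<lambda>p :: 'd point. \<tau>' (snd (snd p))"
    note mult = integrable_mult_time_test[OF \<tau>]
    obtain C where C: "\<And>t. \<bar>\<tau> t\<bar> \<le> C" using time_test_bounded[OF \<tau>] by blast
    have "balance_le T (\<lambda>(x, t). LINT v|lborel. \<bar>f (x, v, t) - g (x, v, t)\<bar>)
        (\<lambda>(x, t). LINT v|lborel. \<bar>f (x, v, t) - g (x, v, t)\<bar> *\<^sub>R v)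
        (\<lambda>(x, t). LINT v|lborel. (?q (x, v, t) - Dg (x, v, t)) * ?s (x, v, t))"
      by (rule dissipative_solution_balance[OF assms(4-6)]) simp
    from balance_time_test[OF this di Si \<tau> \<tau>0]
    have 1: "- (LINT p|?M. \<bar>f p - g p\<bar> * ?t' p) \<le> (LINT p|?M. (?q p - Dg p) * ?s p * ?t p)" .
    \<comment> \<open>For the comparison function 0 the sign is multiplied by Q(f,0) - D(0) = 0, so
      any \<theta> serves; here it is 0.\<close>
    from dissipative_solution_balance[OF assms(4) sufficiently_regular_zero has_transport_derivative_zero, of 0]
    have "balance_le T (\<lambda>(x, t). LINT v|lborel. \<bar>f (x, v, t)\<bar>)
        (\<lambda>(x, t). LINT v|lborel. \<bar>f (x, v, t)\<bar> *\<^sub>R v) (\<lambda>(x, t). LINT v|(lborel :: (real ^ 'd) measure). (0 :: real))"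
      by (simp add: Q_zero)
    from balance_time_test[where R = "\<lambda>p. \<bar>f p\<bar>" and S = "\<lambda>_. 0", OF this integrable_abs[OF fi] _ \<tau> \<tau>0]
    have "- (LINT p|?M. \<bar>f p\<bar> * ?t' p) \<le> 0" by simp
    moreover have "(LINT p|?M. \<bar>f p\<bar> * ?t' p) = (LINT p|?M. f p * ?t' p)"
    proof (rule integral_cong_AE)
      show "AE p in ?M. \<bar>f p\<bar> * ?t' p = f p * ?t' p"
        using f0 by eventually_elim simp
    qed (use mult(2)[OF fi] mult(2)[OF integrable_abs[OF fi]] in simp_all)
    ultimately have 2: "- (LINT p|?M. f p * ?t' p) \<le> 0" by simp
    have 3: "- (LINT p|?M. g p * ?t' p) = (LINT p|?M. Dg p * ?t p)"
      by (rule transport_time_test[OF Deq gi Di \<tau>])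
    have 4: "(LINT p|?M. ?q p * ?t p) = 0"
      using integral_Q_eq_0(2)[OF assms(2) _ _ loss time_test_borel(1)[OF \<tau>] C]
      by (simp add: case_prod_unfold)
    \<comment> \<open>Fact \<open>4\<close> allows the integral of Q(f,g) \<tau>, which is 0, to be
      added: this completes -D(g) to Q(f,g) - D(g), so that the factor sign + 1 can be split
      off.\<close>
    have "(LINT p|?M. (?q p - Dg p) * ?s p * ?t p) - (LINT p|?M. Dg p * ?t p) =
        (LINT p|?M. (?q p - Dg p) * ?s p * ?t p + (?q p * ?t p - Dg p * ?t p))"
      using mult(1)[OF Si] mult(1)[OF qi] mult(1)[OF Di] 4 by simp
    moreover have "(LINT p|?M. (?q p - Dg p) * ?s p * ?t p + (?q p * ?t p - Dg p * ?t p)) \<le> 0"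
    proof -
      have "AE p in ?M. 0 \<le> - ((?q p - Dg p) * ?s p * ?t p + (?q p * ?t p - Dg p * ?t p))"
        using assms(9,10)
      proof eventually_elim
        case (elim p)
        have "(?q p - Dg p) * (?s p + 1) \<le> 0"
        proof (cases "f p > g p")
          case True
          then have "p \<in> U" using elim by force
          then show ?thesis using elim True by (simp add: sign_with_def)
        qed (simp add: sign_with_def)
        then have "(?q p - Dg p) * (?s p + 1) * ?t p \<le> 0"
          using \<tau>0 by (simp add: mult_nonpos_nonneg)
        then show ?case by (simp add: algebra_simps)
      qed
      from integral_nonneg_AE[OF this] show ?thesis
        by (simp only: Bochner_Integration.integral_minus neg_0_le_iff_le)
    qed
    ultimately have 5: "0 \<le> (LINT p|?M. \<bar>f p - g p\<bar> * ?t' p) + (LINT p|?M. f p * ?t' p) - (LINT p|?M. g p * ?t' p)"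
      using 1 2 3 by linarith
    have "(LINT p|?M. \<bar>f p - g p\<bar> * ?t' p) + (LINT p|?M. f p * ?t' p) - (LINT p|?M. g p * ?t' p) =
        (LINT p|?M. W p * ?t' p)"
      using mult(2)[OF di] mult(2)[OF fi] mult(2)[OF gi] by (simp add: W_def distrib_right left_diff_distrib)
    moreover have "(LINT p|?M. W p * ?t' p) = (LINT t|time_measure T. M t * \<tau>' t)"
      using t_xv.integral_disintegrate[OF measurable_t_xv distr_t_xv mult(2)[OF Wi]]
      by (simp add: M_def case_prod_unfold)
    ultimately show ?thesis using 5 by linarith
  qed
  have M_antimono: "M b \<le> M a" if "0 < a" "a < b" "b < T" for a b
  proof (rule continuous_antimono_if_weak_derivative_le_0[OF M_cont _ that])
    fix \<tau> \<tau>' :: "real \<Rightarrow> real"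
    assume "smooth \<tau>" "\<And>t. (\<tau> has_real_derivative \<tau>' t) (at t)" "continuous_on UNIV \<tau>'"
      "\<And>t. 0 \<le> \<tau> t" "\<exists>K. compact K \<and> K \<subseteq> {0<..<T} \<and> (\<forall>t. t \<notin> K \<longrightarrow> \<tau> t = 0)"
    then show "0 \<le> (LINT t|time_measure T. M t * \<tau>' t)"
      by (intro weak[of \<tau>]) (simp_all add: time_test_def)
  qed
  have M0: "M 0 = 0"
  proof -
    have "AE y in xv_measure. (case y of (x, v) \<Rightarrow> W (x, v, 0)) = 0"
      using assms(8) by eventually_elim (auto simp: W_zero)
    then show ?thesis unfolding M_def by (rule integral_eq_zero_AE)
  qed
  have "M b \<le> 0" if b: "b \<in> {0<..<T}" for b
  proof -
    \<comment> \<open>Monotonicity is available only between interior times, so time 0 is approached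
      by b/(n + 2); the shift by 2 keeps even the first term strictly below b.\<close>
    let ?a = "\<lambda>n. b * inverse (real (Suc (Suc n)))"
    have "?a \<longlonglongrightarrow> b * 0"
      using LIMSEQ_Suc[OF LIMSEQ_inverse_real_of_nat] by (rule tendsto_mult_left)
    then have lim: "?a \<longlonglongrightarrow> 0" by simp
    have a: "0 < ?a n" "?a n < b" for n
    proof -
      have "inverse (real (Suc (Suc n))) < 1" by (rule inverse_less_1_iff[THEN iffD2]) simp
      then show "?a n < b" using b mult_strict_left_mono[of "inverse (real (Suc (Suc n)))" 1 b] by simp
      show "0 < ?a n" using b by (intro mult_pos_pos) auto
    qed
    have "?a n \<in> {0..T}" for n
      unfolding atLeastAtMost_iff using a[of n] b unfolding greaterThanLessThan_iff by linarith
    then have "(\<lambda>n. M (?a n)) \<longlonglongrightarrow> M 0"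
      by (intro continuous_on_tendsto_compose[OF M_cont lim] always_eventually allI) (use assms(3) in simp_all)
    moreover have "M b \<le> M (?a n)" for n
      using M_antimono[OF a] b by simp
    ultimately show ?thesis
      using M0 LIMSEQ_le_const[of "\<lambda>n. M (?a n)" "M 0" "M b"] by auto
  qed
  \<comment> \<open>The bound passes from the open interval to its closure, which settles the final
    time T along with time 0.\<close>
  then have M_le: "M t \<le> 0" if "t \<in> {0..T}" for t
    using continuous_le_on_closure[of "{0<..<T}" M t 0] M_cont that assms(3) by simp
  show ?thesis
  proof
    fix t assume t: "t \<in> {0..T}"
    have int: "integrable xv_measure (\<lambda>(x, v). W (x, v, t))"
      using WC t by (simp add: continuous_L1_def)
    have "M t \<ge> 0" unfolding M_def by (rule integral_nonneg_AE) (auto simp: W_nonneg)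
    with M_le[OF t] have "(LINT (x, v)|xv_measure. W (x, v, t)) = 0" by (simp add: M_def)
    then have "AE (x, v) in xv_measure. W (x, v, t) = 0"
      using integral_nonneg_eq_0_iff_AE[OF int] by (auto simp: W_nonneg case_prod_unfold)
    then show "AE (x, v) in xv_measure. f (x, v, t) \<le> g (x, v, t)"
      by (simp add: W_zero)
  qed
qed

end
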